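(* Let $R$ be a factorial domain, $K$ a quotient field of $R$, $X$ an indeterminate over $K$ and $f,g\in R[X]^{\bullet}$ such that ${\rm GCD}_{R[X]}(f,g)=R[X]^{\times}$, ${\rm GCD}_R(f(x),g(x))=R^{\times}$ for all but finitely many $x\in R$, and $d(rs)=d(r)d(s)$ for all $r\in[\![f]\!]$ and $s\in[\![g]\!]$. If $x\in[\![f]\!]$ and $y\in[\![g]\!]$, then $\mathcal{C}_v([\![xy]\!])\cong\mathcal{C}_v([\![x]\!])\times\mathcal{C}_v([\![y]\!])$.
   Context: For a domain $D$, $D^{\bullet}=D\setminus\{0\}$ is a multiplicative monoid, $D^{\times}$ its unit group; ${\rm GCD}_D(a,b)$ is the set of all greatest common divisors of $a,b$ in $D$ (so ${\rm GCD}_D(a,b)=D^{\times}$ means that $a,b$ are coprime). ${\rm Int}(R)=\{h\in K[X]\mid h(c)\in R\text{ for all }c\in R\}$. For $f\in{\rm Int}(R)^{\bullet}$, $[\![f]\!]=\{h\in{\rm Int}(R)^{\bullet}\mid h\text{ divides }f^k\text{ in }{\rm Int}(R)\text{ for some }k\in\mathbb{N}_0\}$; it is known that $[\![f]\!]$ is a Krull monoid. For a monoid $H$ (commutative, cancellative) with quotient group $L$ and $Y\subseteq L$ put $Y^{-1}=\{z\in L\mid zY\subseteq H\}$ and $Y_v=(Y^{-1})^{-1}$. For a Krull monoid $H$, the divisor-class group $\mathcal{C}_v(H)$ is the group of nonempty fractional $v$-ideals of $H$ under $(I,J)\mapsto(IJ)_v$ modulo the subgroup of principal fractional ideals. Fix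 a system $\mathcal{Q}$ of representatives (up to associates) of the prime elements of $R$; for $p\in\mathcal{Q}$, $\mathrm{v}_p:R\to\mathbb{N}_0\cup\{\infty\}$ is the $p$-adic valuation, and $d:{\rm Int}(R)^{\bullet}\to R^{\bullet}$ is defined by $d(h)=\prod_{p\in\mathcal{Q}}p^{\min\{\mathrm{v}_p(h(c))\mid c\in R\}}$. *)

theory Defs
  imports
    "HOL-Computational_Algebra.Computational_Algebra"
    "HOL-Library.Extended_Nat"
    "HOL-Algebra.Coset"
begin

text \<open>
  A factorial domain is a type of sort \<open>{factorial_semiring, idom}\<close>, its quotient field is the
  library's \<open>'a fract\<close>.  The operations \<open>normalize\<close>, \<open>unit_factor\<close> and \<open>div\<close> that this sort
  carries exist (by choice) on every factorial domain and are not used by the definitions below.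
\<close>

definition GCD_set :: "'a::comm_semiring_1 \<Rightarrow> 'a \<Rightarrow> 'a set" where
  "GCD_set a b = {d. d dvd a \<and> d dvd b \<and> (\<forall>e. e dvd a \<and> e dvd b \<longrightarrow> e dvd d)}"

definition units :: "'a::comm_semiring_1 set" where
  "units = {u. u dvd 1}"

definition int_valued :: "'a::idom fract poly set" where
  "int_valued = {h. \<forall>c. poly h (to_fract c) \<in> range to_fract}"

definition monadic :: "'a::idom fract poly \<Rightarrow> 'a fract poly set" where
  "monadic f = {h \<in> int_valued - {0}. \<exists>k::nat. \<exists>q\<in>int_valued. f ^ k = h * q}"

definition prime_reps :: "'a::comm_semiring_1 set \<Rightarrow> bool" where
  "prime_reps Q \<longleftrightarrow>
     (\<forall>q\<in>Q. prime_elem q) \<and> (\<forall>p. prime_elem p \<longrightarrow> (\<exists>!q. q \<in> Q \<and> q dvd p \<and> p dvd q))"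

definition val :: "'a::factorial_semiring \<Rightarrow> 'a \<Rightarrow> enat" where
  "val p a = (if a = 0 then \<infinity> else enat (multiplicity p a))"

definition int_eval :: "'a::idom fract poly \<Rightarrow> 'a \<Rightarrow> 'a" where
  "int_eval h c = the_inv to_fract (poly h (to_fract c))"

text \<open>
  For nonzero integer-valued \<open>h\<close> and \<open>p \<in> Q\<close> the infimum is an attained finite minimum: if the
  domain is infinite then \<open>h\<close> has a nonzero value, and if it is finite then it is a field and
  \<open>Q = {}\<close>.
\<close>

definition min_val :: "'a::{factorial_semiring,idom} \<Rightarrow> 'a fract poly \<Rightarrow> nat" where
  "min_val p h = the_enat (INF c. val p (int_eval h c))"

text \<open>
  The product is restricted to the (finite) set of primes with nonzero exponent, because
  \<open>prod\<close> over an infinite index set is \<open>1\<close>.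
\<close>

definition fixed_div :: "'a::{factorial_semiring,idom} set \<Rightarrow> 'a fract poly \<Rightarrow> 'a" where
  "fixed_div Q h = (\<Prod>p \<in> {p \<in> Q. min_val p h \<noteq> 0}. p ^ min_val p h)"

text \<open>
  In the following, \<open>H\<close> is a multiplicative submonoid of a field not containing \<open>0\<close>; its quotient
  group is then formed inside that field.
\<close>

definition quot_group :: "'b::field set \<Rightarrow> 'b set" where
  "quot_group H = {a / b | a b. a \<in> H \<and> b \<in> H}"

definition inv_ideal :: "'b::field set \<Rightarrow> 'b set \<Rightarrow> 'b set" where
  "inv_ideal H Y = {z \<in> quot_group H. \<forall>y\<in>Y. z * y \<in> H}"

definition v_closure :: "'b::field set \<Rightarrow> 'b set \<Rightarrow> 'b set" where
  "v_closure H Y = inv_ideal H (inv_ideal H Y)"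

definition frac_v_ideals :: "'b::field set \<Rightarrow> 'b set set" where
  "frac_v_ideals H =
     {I. I \<subseteq> quot_group H \<and> I \<noteq> {} \<and> (\<exists>c\<in>H. \<forall>y\<in>I. c * y \<in> H) \<and> v_closure H I = I}"

definition v_ideal_group :: "'b::field set \<Rightarrow> 'b set monoid" where
  "v_ideal_group H =
     \<lparr>carrier = frac_v_ideals H,
      mult = (\<lambda>I J. v_closure H {a * b | a b. a \<in> I \<and> b \<in> J}),
      one = H\<rparr>"

definition principal_ideals :: "'b::field set \<Rightarrow> 'b set set" where
  "principal_ideals H = {(*) z ` H | z. z \<in> quot_group H}"

definition class_group :: "'b::field set \<Rightarrow> 'b set set monoid" where
  "class_group H = v_ideal_group H Mod principal_ideals H"

text \<open>
  A submonoid of the nonzero integer-valued polynomials is viewed inside the field of rational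
  functions \<open>'a fract poly fract\<close>.
\<close>

definition monadic_class_group :: "'a::idom fract poly \<Rightarrow> 'a fract poly fract set set monoid" where
  "monadic_class_group f = class_group (to_fract ` monadic f)"

end

theory Submission
  imports Defs "HOL-Library.Set_Algebras"
begin

text \<open>
  Let \<open>K\<close> be the quotient field of the factorial domain \<open>R\<close>.  Coprimality of \<open>f\<close> and \<open>g\<close> splits a
  divisor \<open>h\<close> of \<open>(x y)\<^sup>k\<close> over \<open>K\<close> as \<open>h = A B\<close> with \<open>A A' = x\<^sup>k\<close> and \<open>B B' = y\<^sup>k\<close>.
  Multiplicativity of \<open>d\<close> gives \<open>A(s) B(t) \<in> R\<close> for all \<open>s, t\<close> whenever \<open>A B\<close> is integer-valued.
  The element \<open>A(s) A'(t)\<close> becomes a ring element after multiplication by a power of \<open>g(t)\<close> and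
  also after multiplication by a power of \<open>f(t)\<close>; these values are coprime, so it lies in \<open>R\<close>.
  Scaling \<open>A\<close> by the inverse of a greatest common divisor of the values of \<open>A\<close> and \<open>B'\<close>
  therefore gives \<open>[[x y]] = [[x]] [[y]]\<close>, and clearing denominators in the same way shows that such
  a factorisation is unique up to units of \<open>R\<close>.  Every \<open>v\<close>-ideal of a product of monoids is the
  product of its components, so the class groups multiply.
\<close>

subsection \<open>Quotients of direct products\<close>

lemma hom_image_set_mult:
  assumes "k \<in> hom G G'" "C \<subseteq> carrier G" "D \<subseteq> carrier G"
  shows "k ` (C <#>\<^bsub>G\<^esub> D) = k ` C <#>\<^bsub>G'\<^esub> k ` D"
proof -
  have "k (a \<otimes>\<^bsub>G\<^esub> b) = k a \<otimes>\<^bsub>G'\<^esub> k b" if "a \<in> C" "b \<in> D" for a b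
    using assms that by (intro hom_mult) auto
  then show ?thesis
    by (force simp: set_mult_def)
qed

lemma fst_image_set_mult_DirProd: "fst ` (C <#>\<^bsub>G1 \<times>\<times> G2\<^esub> D) = fst ` C <#>\<^bsub>G1\<^esub> fst ` D"
  and snd_image_set_mult_DirProd: "snd ` (C <#>\<^bsub>G1 \<times>\<times> G2\<^esub> D) = snd ` C <#>\<^bsub>G2\<^esub> snd ` D"
  by (force simp: set_mult_def DirProd_def)+

lemma r_coset_eq_set_mult: "N #>\<^bsub>G\<^esub> a = N <#>\<^bsub>G\<^esub> {a}"
  by (auto simp: r_coset_def set_mult_def)

lemma set_mult_DirProd_Times:
  "(A1 \<times> A2) <#>\<^bsub>G1 \<times>\<times> G2\<^esub> (B1 \<times> B2) = (A1 <#>\<^bsub>G1\<^esub> B1) \<times> (A2 <#>\<^bsub>G2\<^esub> B2)"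
  by (force simp: set_mult_def DirProd_def)

text \<open>A coset of \<open>N1 \<times> N2\<close> is a product of nonempty sets, so it is determined by its two
  projections.\<close>

lemma FactGroup_DirProd_is_iso:
  assumes k: "k \<in> iso G (G1 \<times>\<times> G2)"
    and closed: "\<And>a b. a \<in> carrier G \<Longrightarrow> b \<in> carrier G \<Longrightarrow> a \<otimes>\<^bsub>G\<^esub> b \<in> carrier G"
    and N: "N \<subseteq> carrier G" "k ` N = N1 \<times> N2" "N1 \<noteq> {}" "N2 \<noteq> {}"
  shows "G Mod N \<cong> (G1 Mod N1) \<times>\<times> (G2 Mod N2)"
proof -
  define \<psi> where "\<psi> C = (fst ` k ` C, snd ` k ` C)" for C
  have hom: "k \<in> hom G (G1 \<times>\<times> G2)" and bij: "bij_betw k (carrier G) (carrier G1 \<times> carrier G2)"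
    using k by (auto simp: iso_def)
  \<comment> \<open>Cosets must stay inside the carrier, because \<open>k\<close> is injective only
    there; this is what the closure hypothesis is for.\<close>
  have sub: "N #>\<^bsub>G\<^esub> a \<subseteq> carrier G" if "a \<in> carrier G" for a
    using closed N(1) that by (auto simp: r_coset_def)
  have k_coset: "k ` (N #>\<^bsub>G\<^esub> a) = (N1 #>\<^bsub>G1\<^esub> fst (k a)) \<times> (N2 #>\<^bsub>G2\<^esub> snd (k a))"
    if "a \<in> carrier G" for a
  proof -
    have "k ` (N #>\<^bsub>G\<^esub> a) = (N1 \<times> N2) <#>\<^bsub>G1 \<times>\<times> G2\<^esub> {k a}"
      using hom_image_set_mult[OF hom N(1), of "{a}"] that N(2) by (simp add: r_coset_eq_set_mult)
    also have "{k a} = {fst (k a)} \<times> {snd (k a)}"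
      by simp
    finally show ?thesis
      by (simp only: set_mult_DirProd_Times r_coset_eq_set_mult)
  qed
  have ne: "N1 #>\<^bsub>G1\<^esub> a \<noteq> {}" "N2 #>\<^bsub>G2\<^esub> b \<noteq> {}" for a b
    using N by (auto simp: r_coset_def)
  have psi_coset: "\<psi> (N #>\<^bsub>G\<^esub> a) = (N1 #>\<^bsub>G1\<^esub> fst (k a), N2 #>\<^bsub>G2\<^esub> snd (k a))"
    if "a \<in> carrier G" for a
    by (simp add: \<psi>_def k_coset that ne)
  have "\<psi> \<in> hom (G Mod N) ((G1 Mod N1) \<times>\<times> (G2 Mod N2))"
  proof (rule homI)
    fix C assume "C \<in> carrier (G Mod N)"
    then obtain a where a: "a \<in> carrier G" "C = N #>\<^bsub>G\<^esub> a"
      by (auto simp: carrier_FactGroup)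
    then have "k a \<in> carrier G1 \<times> carrier G2"
      using bij by (auto simp: bij_betw_def)
    with a show "\<psi> C \<in> carrier ((G1 Mod N1) \<times>\<times> (G2 Mod N2))"
      by (auto simp: carrier_FactGroup psi_coset)
  next
    fix C D assume "C \<in> carrier (G Mod N)" "D \<in> carrier (G Mod N)"
    then have "C \<subseteq> carrier G" "D \<subseteq> carrier G"
      using sub by (auto simp: carrier_FactGroup)
    then have "k ` (C <#>\<^bsub>G\<^esub> D) = k ` C <#>\<^bsub>G1 \<times>\<times> G2\<^esub> k ` D"
      by (rule hom_image_set_mult[OF hom])
    then show "\<psi> (C \<otimes>\<^bsub>G Mod N\<^esub> D) = \<psi> C \<otimes>\<^bsub>(G1 Mod N1) \<times>\<times> (G2 Mod N2)\<^esub> \<psi> D"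
      by (simp add: \<psi>_def fst_image_set_mult_DirProd snd_image_set_mult_DirProd)
  qed
  moreover have "inj_on \<psi> (carrier (G Mod N))"
  proof (rule inj_onI)
    fix C D assume C: "C \<in> carrier (G Mod N)" and D: "D \<in> carrier (G Mod N)" and eq: "\<psi> C = \<psi> D"
    have times: "k ` E = fst (\<psi> E) \<times> snd (\<psi> E)" if "E \<in> carrier (G Mod N)" for E
      using that unfolding carrier_FactGroup by (elim imageE) (simp only: psi_coset k_coset fst_conv snd_conv)
    have "k ` C = k ` D"
      using times[OF C] times[OF D] eq by simp
    moreover have "C \<subseteq> carrier G" "D \<subseteq> carrier G"
      using C D sub by (auto simp: carrier_FactGroup)
    ultimately show "C = D"
      using bij inj_on_image_eq_iff unfolding bij_betw_def by blast
  qed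
  moreover have "\<psi> ` carrier (G Mod N) = carrier ((G1 Mod N1) \<times>\<times> (G2 Mod N2))"
  proof -
    have "\<psi> ` carrier (G Mod N)
        = (\<lambda>(a, b). (N1 #>\<^bsub>G1\<^esub> a, N2 #>\<^bsub>G2\<^esub> b)) ` k ` carrier G"
      by (auto simp: carrier_FactGroup psi_coset image_image case_prod_beta intro!: image_cong)
    also have "k ` carrier G = carrier G1 \<times> carrier G2"
      using bij by (simp add: bij_betw_def)
    finally show ?thesis
      by (auto simp: carrier_FactGroup)
  qed
  ultimately show ?thesis
    by (auto simp: is_iso_def iso_def bij_betw_def)
qed

subsection \<open>Divisorial ideals of a product of monoids\<close>

locale field_submonoid =
  fixes H :: "'b::field set"
  assumes zero_notin: "0 \<notin> H"
    and one_in: "1 \<in> H"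
    and mult_in: "a \<in> H \<Longrightarrow> b \<in> H \<Longrightarrow> a * b \<in> H"
begin

lemma in_quot: "a \<in> H \<Longrightarrow> a \<in> quot_group H"
  unfolding quot_group_def using one_in by (force intro: exI[of _ a] exI[of _ 1])

lemma quot_nonzero: "a \<in> quot_group H \<Longrightarrow> a \<noteq> 0"
  using zero_notin by (auto simp: quot_group_def)

lemma quot_mult: "a \<in> quot_group H \<Longrightarrow> b \<in> quot_group H \<Longrightarrow> a * b \<in> quot_group H"
  unfolding quot_group_def using mult_in by (force simp: times_divide_times_eq)

lemma quot_inverse: "a \<in> quot_group H \<Longrightarrow> inverse a \<in> quot_group H"
  unfolding quot_group_def by force

lemma quot_divide: "a \<in> quot_group H \<Longrightarrow> b \<in> quot_group H \<Longrightarrow> a / b \<in> quot_group H"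
  by (simp add: divide_inverse quot_mult quot_inverse)

text \<open>A nonempty inverse amounts to a common denominator in \<open>H\<close> (see
  \<open>frac_v_ideals_iff\<close>); in this form the condition passes directly to inverses and to
  products of sets.\<close>

definition fractional :: "'b set \<Rightarrow> bool" where
  "fractional Y \<longleftrightarrow> Y \<subseteq> quot_group H \<and> Y \<noteq> {} \<and> inv_ideal H Y \<noteq> {}"

lemma inv_ideal_subset: "inv_ideal H Y \<subseteq> quot_group H"
  by (auto simp: inv_ideal_def)

lemma inv_ideal_stable: "h \<in> H \<Longrightarrow> z \<in> inv_ideal H Y \<Longrightarrow> h * z \<in> inv_ideal H Y"
  by (auto simp: inv_ideal_def mult_in in_quot quot_mult mult.assoc)

lemma subset_v_closure: "Y \<subseteq> quot_group H \<Longrightarrow> Y \<subseteq> v_closure H Y"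
  by (auto simp: v_closure_def inv_ideal_def mult.commute)

text \<open>\<open>inv_ideal\<close> is antitone and \<open>Y\<close> lies in its v-closure, so
  inverting three times is the same as inverting once.\<close>

lemma v_closure_inv_ideal:
  assumes "Y \<subseteq> quot_group H"
  shows "v_closure H (inv_ideal H Y) = inv_ideal H Y"
proof
  show "inv_ideal H Y \<subseteq> v_closure H (inv_ideal H Y)"
    by (rule subset_v_closure[OF inv_ideal_subset])
  show "v_closure H (inv_ideal H Y) \<subseteq> inv_ideal H Y"
    using subset_v_closure[OF assms] by (auto simp: v_closure_def inv_ideal_def)
qed

lemma frac_v_ideals_iff: "I \<in> frac_v_ideals H \<longleftrightarrow> fractional I \<and> v_closure H I = I"
proof
  assume I: "I \<in> frac_v_ideals H"
  then obtain c where "c \<in> H" "\<forall>y\<in>I. c * y \<in> H"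
    by (auto simp: frac_v_ideals_def)
  then have "c \<in> inv_ideal H I"
    by (auto simp: inv_ideal_def in_quot)
  with I show "fractional I \<and> v_closure H I = I"
    by (auto simp: fractional_def frac_v_ideals_def)
next
  assume I: "fractional I \<and> v_closure H I = I"
  then obtain z where z: "z \<in> quot_group H" "\<forall>y\<in>I. z * y \<in> H"
    by (auto simp: fractional_def inv_ideal_def)
  from z(1) obtain a b where ab: "a \<in> H" "b \<in> H" "z = a / b"
    by (auto simp: quot_group_def)
  \<comment> \<open>The numerator \<open>a\<close> of \<open>z\<close> is a common denominator of
    \<open>I\<close> that lies in \<open>H\<close> itself, since \<open>a * y\<close> is
    \<open>b\<close> times \<open>z * y\<close>.\<close>
  have "a * y \<in> H" if "y \<in> I" for y
  proof -
    have "a * y = b * (z * y)"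
      using ab zero_notin by (cases "b = 0") auto
    moreover have "b * (z * y) \<in> H"
      using mult_in ab(2) z(2) that by blast
    ultimately show ?thesis
      by (simp only:)
  qed
  with ab(1) have "\<exists>c\<in>H. \<forall>y\<in>I. c * y \<in> H"
    by blast
  with I show "I \<in> frac_v_ideals H"
    by (simp add: fractional_def frac_v_ideals_def)
qed

lemma fractional_inv_ideal: "fractional Y \<Longrightarrow> fractional (inv_ideal H Y)"
  using subset_v_closure[of Y] inv_ideal_subset[of Y] unfolding fractional_def v_closure_def by blast

lemma inv_ideal_frac: "fractional Y \<Longrightarrow> inv_ideal H Y \<in> frac_v_ideals H"
  using frac_v_ideals_iff fractional_inv_ideal v_closure_inv_ideal by (auto simp: fractional_def)

lemma v_closure_frac: "fractional Y \<Longrightarrow> v_closure H Y \<in> frac_v_ideals H"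
  by (simp add: v_closure_def inv_ideal_frac fractional_inv_ideal)

lemma fractional_times:
  assumes "fractional Y" "fractional Z"
  shows "fractional (Y * Z)"
proof -
  obtain y z where yz: "y \<in> inv_ideal H Y" "z \<in> inv_ideal H Z"
    using assms by (auto simp: fractional_def)
  have "y * z * (a * b) \<in> H" if "a \<in> Y" "b \<in> Z" for a b
    using yz that mult_in[of "y * a" "z * b"] by (auto simp: inv_ideal_def ac_simps)
  then have "y * z \<in> inv_ideal H (Y * Z)"
    using yz by (auto simp: inv_ideal_def quot_mult elim!: set_times_elim)
  moreover have "a * b \<in> quot_group H" if "a \<in> Y" "b \<in> Z" for a b
    using assms that by (auto simp: fractional_def intro: quot_mult)
  moreover have "Y * Z \<noteq> {}"
    using assms by (auto simp: fractional_def intro: set_times_intro)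
  ultimately show ?thesis
    by (auto simp: fractional_def elim!: set_times_elim)
qed

text \<open>As \<open>H\<close> contains \<open>1\<close> and is closed under products, an element
  \<open>w\<close> needs to be tested only against the generator \<open>z\<close>.\<close>

lemma inv_ideal_principal:
  assumes "z \<in> quot_group H"
  shows "inv_ideal H ((*) z ` H) = (*) (inverse z) ` H"
proof -
  have z: "z \<noteq> 0" "inverse z \<in> quot_group H"
    using assms by (auto simp: quot_nonzero quot_inverse)
  have "w \<in> inv_ideal H ((*) z ` H) \<longleftrightarrow> w \<in> quot_group H \<and> z * w \<in> H" for w
    using one_in mult_in[of "z * w"] by (auto simp: inv_ideal_def ac_simps)
  moreover have "w \<in> quot_group H \<and> z * w \<in> H \<longleftrightarrow> w \<in> (*) (inverse z) ` H" for w
  proof -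
    have "w \<in> quot_group H" if "z * w \<in> H"
      using quot_mult[OF z(2) in_quot[OF that]] z(1) by (simp flip: mult.assoc)
    moreover have "z * w \<in> H \<longleftrightarrow> w \<in> (*) (inverse z) ` H"
      using z(1) by (auto simp: image_iff field_simps)
    ultimately show ?thesis by blast
  qed
  ultimately show ?thesis by blast
qed

text \<open>A v-ideal is the inverse of its inverse, and inverses are closed under multiplication by
  \<open>H\<close>.\<close>

lemma v_ideal_stable: "I \<in> frac_v_ideals H \<Longrightarrow> h \<in> H \<Longrightarrow> a \<in> I \<Longrightarrow> h * a \<in> I"
  using inv_ideal_stable[of h a "inv_ideal H I"] by (auto simp: frac_v_ideals_iff v_closure_def)

lemma principal_subset: "principal_ideals H \<subseteq> frac_v_ideals H"
proof
  fix P assume "P \<in> principal_ideals H"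
  then obtain z where z: "z \<in> quot_group H" "P = (*) z ` H"
    by (auto simp: principal_ideals_def)
  then have inv: "inv_ideal H P = (*) (inverse z) ` H" "v_closure H P = P"
    by (auto simp: v_closure_def inv_ideal_principal quot_inverse)
  moreover have "P \<subseteq> quot_group H" "P \<noteq> {}"
    using z one_in by (auto simp: quot_mult in_quot)
  ultimately show "P \<in> frac_v_ideals H"
    using one_in by (auto simp: frac_v_ideals_iff fractional_def)
qed

lemma mult_v_ideal_group: "I \<otimes>\<^bsub>v_ideal_group H\<^esub> J = v_closure H (I * J)"
proof -
  have "{a * b | a b. a \<in> I \<and> b \<in> J} = I * J"
    by (auto simp: set_times_def)
  then show ?thesis
    by (simp add: v_ideal_group_def)
qed

lemma carrier_v_ideal_group: "carrier (v_ideal_group H) = frac_v_ideals H"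
  by (simp add: v_ideal_group_def)

end

section \<open>Projections and decomposition of v-ideals of a product monoid\<close>

definition component :: "'b::field set \<Rightarrow> 'b set \<Rightarrow> 'b set \<Rightarrow> 'b set" where
  "component L M J = {a \<in> L. \<exists>b\<in>M. a * b \<in> J}"

text \<open>The hypothesis \<open>split\<close> says that the group generated by \<open>H1\<close> and \<open>H2\<close> is their direct
  product modulo units and that \<open>H1 * H2\<close> is the product monoid in it.\<close>

locale product_submonoids = H1: field_submonoid H1 + H2: field_submonoid H2
  for H1 H2 :: "'b::field set" +
  assumes split: "a \<in> quot_group H1 \<Longrightarrow> b \<in> quot_group H2 \<Longrightarrow> a * b \<in> H1 * H2 \<Longrightarrow> a \<in> H1 \<and> b \<in> H2"
begin

sublocale H: field_submonoid "H1 * H2"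
proof
  show "0 \<notin> H1 * H2"
    using H1.zero_notin H2.zero_notin by (auto elim!: set_times_elim)
  show "1 \<in> H1 * H2"
    using set_times_intro[OF H1.one_in H2.one_in] by simp
  fix a b assume "a \<in> H1 * H2" "b \<in> H1 * H2"
  then obtain a1 a2 b1 b2 where *: "a1 \<in> H1" "a2 \<in> H2" "a = a1 * a2" "b1 \<in> H1" "b2 \<in> H2" "b = b1 * b2"
    by (auto elim!: set_times_elim)
  then have "(a1 * b1) * (a2 * b2) \<in> H1 * H2"
    by (intro set_times_intro H1.mult_in H2.mult_in)
  with * show "a * b \<in> H1 * H2"
    by (simp add: ac_simps)
qed

lemma quot_times: "quot_group (H1 * H2) = quot_group H1 * quot_group H2"
proof
  show "quot_group (H1 * H2) \<subseteq> quot_group H1 * quot_group H2"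
  proof
    fix z assume "z \<in> quot_group (H1 * H2)"
    then obtain a1 a2 b1 b2 where *: "a1 \<in> H1" "a2 \<in> H2" "b1 \<in> H1" "b2 \<in> H2" "z = (a1 * a2) / (b1 * b2)"
      unfolding quot_group_def by (auto elim!: set_times_elim)
    then have "z = (a1 / b1) * (a2 / b2)"
      by simp
    moreover have "a1 / b1 \<in> quot_group H1" "a2 / b2 \<in> quot_group H2"
      using * by (auto simp: quot_group_def)
    ultimately show "z \<in> quot_group H1 * quot_group H2"
      by (simp only: set_times_intro)
  qed
  show "quot_group H1 * quot_group H2 \<subseteq> quot_group (H1 * H2)"
    unfolding quot_group_def
    by (force elim!: set_times_elim simp: times_divide_times_eq intro: set_times_intro)
qed

text \<open>Although factorisations are not unique, \<open>split\<close> applied to the regrouped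
  product decides membership in each component separately.\<close>

lemma split_iff:
  assumes "z1 \<in> quot_group H1" "z2 \<in> quot_group H2" "y1 \<in> quot_group H1" "y2 \<in> quot_group H2"
  shows "(z1 * z2) * (y1 * y2) \<in> H1 * H2 \<longleftrightarrow> z1 * y1 \<in> H1 \<and> z2 * y2 \<in> H2"
proof -
  have eq: "(z1 * z2) * (y1 * y2) = (z1 * y1) * (z2 * y2)"
    by (simp add: ac_simps)
  have "z1 * y1 \<in> quot_group H1" "z2 * y2 \<in> quot_group H2"
    using assms H1.quot_mult H2.quot_mult by blast+
  then show ?thesis
    unfolding eq using split by (blast intro: set_times_intro)
qed

lemma inv_ideal_times:
  assumes "Y1 \<subseteq> quot_group H1" "Y2 \<subseteq> quot_group H2" "Y1 \<noteq> {}" "Y2 \<noteq> {}"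
  shows "inv_ideal (H1 * H2) (Y1 * Y2) = inv_ideal H1 Y1 * inv_ideal H2 Y2"
proof -
  have key: "(z1 * z2) * (y1 * y2) \<in> H1 * H2 \<longleftrightarrow> z1 * y1 \<in> H1 \<and> z2 * y2 \<in> H2"
    if "z1 \<in> quot_group H1" "z2 \<in> quot_group H2" "y1 \<in> Y1" "y2 \<in> Y2" for z1 z2 y1 y2
    using that assms by (intro split_iff) auto
  show ?thesis
  proof
    show "inv_ideal (H1 * H2) (Y1 * Y2) \<subseteq> inv_ideal H1 Y1 * inv_ideal H2 Y2"
    proof
      fix z assume z: "z \<in> inv_ideal (H1 * H2) (Y1 * Y2)"
      then obtain z1 z2 where z12: "z1 \<in> quot_group H1" "z2 \<in> quot_group H2" "z = z1 * z2"
        by (auto simp: inv_ideal_def quot_times elim!: set_times_elim)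
      then have "z1 * y1 \<in> H1 \<and> z2 * y2 \<in> H2" if "y1 \<in> Y1" "y2 \<in> Y2" for y1 y2
        using key[OF z12(1,2) that] z that by (auto simp: inv_ideal_def intro: set_times_intro)
      \<comment> \<open>Each factor needs a partner from the other set before \<open>key\<close> can
        be applied; this is where nonemptiness enters.\<close>
      then have "z1 \<in> inv_ideal H1 Y1" "z2 \<in> inv_ideal H2 Y2"
        using z12 assms(3,4) by (auto simp: inv_ideal_def)
      then show "z \<in> inv_ideal H1 Y1 * inv_ideal H2 Y2"
        using z12 by (auto intro: set_times_intro)
    qed
    show "inv_ideal H1 Y1 * inv_ideal H2 Y2 \<subseteq> inv_ideal (H1 * H2) (Y1 * Y2)"
    proof
      fix z assume "z \<in> inv_ideal H1 Y1 * inv_ideal H2 Y2"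
      then obtain z1 z2 where z: "z1 \<in> inv_ideal H1 Y1" "z2 \<in> inv_ideal H2 Y2" "z = z1 * z2"
        by (auto elim!: set_times_elim)
      then have zq: "z1 \<in> quot_group H1" "z2 \<in> quot_group H2"
        using H1.inv_ideal_subset H2.inv_ideal_subset by auto
      have "z * y \<in> H1 * H2" if "y \<in> Y1 * Y2" for y
        using that key[OF zq] z unfolding inv_ideal_def by (auto elim!: set_times_elim)
      then show "z \<in> inv_ideal (H1 * H2) (Y1 * Y2)"
        using z zq by (auto simp: inv_ideal_def quot_times intro: set_times_intro)
    qed
  qed
qed

text \<open>\<open>inv_ideal_times\<close> is applied twice; fractionality keeps the intermediate
  inverses nonempty.\<close>

lemma v_closure_times:
  assumes "H1.fractional Y1" "H2.fractional Y2"
  shows "v_closure (H1 * H2) (Y1 * Y2) = v_closure H1 Y1 * v_closure H2 Y2"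
  using assms H1.fractional_inv_ideal[of Y1] H2.fractional_inv_ideal[of Y2]
  by (simp add: v_closure_def inv_ideal_times H1.fractional_def H2.fractional_def)

lemma fractional_times:
  assumes "H1.fractional Y1" "H2.fractional Y2"
  shows "H.fractional (Y1 * Y2)"
proof -
  have "Y1 * Y2 \<noteq> {}" "inv_ideal H1 Y1 * inv_ideal H2 Y2 \<noteq> {}"
    using assms unfolding H1.fractional_def H2.fractional_def by (auto intro: set_times_intro)
  moreover have "Y1 * Y2 \<subseteq> quot_group (H1 * H2)"
    using assms unfolding H1.fractional_def H2.fractional_def quot_times
    by (auto intro!: set_times_intro elim!: set_times_elim)
  ultimately show ?thesis
    using assms by (simp add: H.fractional_def inv_ideal_times H1.fractional_def H2.fractional_def)
qed

lemma times_frac: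
  assumes "I1 \<in> frac_v_ideals H1" "I2 \<in> frac_v_ideals H2"
  shows "I1 * I2 \<in> frac_v_ideals (H1 * H2)"
  using assms
  by (simp add: H1.frac_v_ideals_iff H2.frac_v_ideals_iff H.frac_v_ideals_iff v_closure_times
      fractional_times)

abbreviation "pr1 \<equiv> component (quot_group H1) (quot_group H2)"
abbreviation "pr2 \<equiv> component (quot_group H2) (quot_group H1)"

text \<open>Here \<open>J\<close> need not be a product of sets. Its inverse still is one, because
  by \<open>split_iff\<close> the conditions on \<open>z1\<close> and \<open>z2\<close> involve only
  the respective coordinates of elements of \<open>J\<close>.\<close>

lemma inv_ideal_components:
  assumes "J \<subseteq> quot_group (H1 * H2)"
  shows "inv_ideal (H1 * H2) J = inv_ideal H1 (pr1 J) * inv_ideal H2 (pr2 J)"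
proof
  show "inv_ideal (H1 * H2) J \<subseteq> inv_ideal H1 (pr1 J) * inv_ideal H2 (pr2 J)"
  proof
    fix z assume z: "z \<in> inv_ideal (H1 * H2) J"
    then obtain z1 z2 where z12: "z1 \<in> quot_group H1" "z2 \<in> quot_group H2" "z = z1 * z2"
      by (auto simp: inv_ideal_def quot_times elim!: set_times_elim)
    have "z1 * y1 \<in> H1 \<and> z2 * y2 \<in> H2"
      if "y1 \<in> quot_group H1" "y2 \<in> quot_group H2" "y1 * y2 \<in> J" for y1 y2
      using split_iff[OF z12(1,2) that(1,2)] z that z12 by (auto simp: inv_ideal_def)
    then have "z1 \<in> inv_ideal H1 (pr1 J)" "z2 \<in> inv_ideal H2 (pr2 J)"
      using z12 by (auto simp: inv_ideal_def component_def mult.commute)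
    then show "z \<in> inv_ideal H1 (pr1 J) * inv_ideal H2 (pr2 J)"
      using z12 by (auto intro: set_times_intro)
  qed
  show "inv_ideal H1 (pr1 J) * inv_ideal H2 (pr2 J) \<subseteq> inv_ideal (H1 * H2) J"
  proof
    fix z assume "z \<in> inv_ideal H1 (pr1 J) * inv_ideal H2 (pr2 J)"
    then obtain z1 z2 where z: "z1 \<in> inv_ideal H1 (pr1 J)" "z2 \<in> inv_ideal H2 (pr2 J)" "z = z1 * z2"
      by (auto elim!: set_times_elim)
    have zq: "z1 \<in> quot_group H1" "z2 \<in> quot_group H2"
      using z H1.inv_ideal_subset H2.inv_ideal_subset by auto
    have "z * y \<in> H1 * H2" if "y \<in> J" for y
    proof -
      from that assms obtain y1 y2 where y: "y1 \<in> quot_group H1" "y2 \<in> quot_group H2" "y = y1 * y2"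
        by (auto simp: quot_times elim!: set_times_elim)
      then have "y1 \<in> pr1 J" "y2 \<in> pr2 J"
        using that by (auto simp: component_def mult.commute)
      then have "z1 * y1 \<in> H1" "z2 * y2 \<in> H2"
        using z by (auto simp: inv_ideal_def)
      then show ?thesis
        using split_iff[OF zq y(1,2)] y z by simp
    qed
    then show "z \<in> inv_ideal (H1 * H2) J"
      using z zq by (auto simp: inv_ideal_def quot_times intro: set_times_intro)
  qed
qed

text \<open>A v-ideal is the inverse of some set, namely of its own inverse \<open>J\<close>, so it
  factors by \<open>inv_ideal_components\<close>.\<close>

lemma frac_v_ideal_times_ex:
  assumes "I \<in> frac_v_ideals (H1 * H2)"
  shows "\<exists>I1\<in>frac_v_ideals H1. \<exists>I2\<in>frac_v_ideals H2. I = I1 * I2"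
proof -
  define J where "J = inv_ideal (H1 * H2) I"
  have I: "H.fractional I" "inv_ideal (H1 * H2) J = I"
    using assms by (auto simp: H.frac_v_ideals_iff v_closure_def J_def)
  have J: "J \<subseteq> quot_group (H1 * H2)" "J \<noteq> {}"
    using H.fractional_inv_ideal[OF I(1)] by (auto simp: J_def H.fractional_def)
  have eq: "I = inv_ideal H1 (pr1 J) * inv_ideal H2 (pr2 J)"
    using inv_ideal_components[OF J(1)] I by simp
  have "I \<noteq> {}"
    using I by (auto simp: H.fractional_def)
  then have "inv_ideal H1 (pr1 J) \<noteq> {}" "inv_ideal H2 (pr2 J) \<noteq> {}"
    unfolding eq by (auto elim!: set_times_elim)
  moreover obtain y1 y2 where "y1 \<in> quot_group H1" "y2 \<in> quot_group H2" "y1 * y2 \<in> J"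
    using J unfolding quot_times by (fast elim: set_times_elim)
  then have "y1 \<in> pr1 J" "y2 \<in> pr2 J"
    by (auto simp: component_def mult.commute)
  ultimately have "H1.fractional (pr1 J)" "H2.fractional (pr2 J)"
    by (auto simp: H1.fractional_def H2.fractional_def component_def)
  then show ?thesis
    using eq H1.inv_ideal_frac H2.inv_ideal_frac by blast
qed

text \<open>Two factorisations of an element differ by units, and v-ideals absorb units, so the
  projections recover the factors.\<close>

lemma component_times:
  assumes I1: "I1 \<in> frac_v_ideals H1" and I2: "I2 \<in> frac_v_ideals H2"
  shows "pr1 (I1 * I2) = I1" and "pr2 (I1 * I2) = I2"
proof -
  have sub: "I1 \<subseteq> quot_group H1" "I2 \<subseteq> quot_group H2" and ne: "I1 \<noteq> {}" "I2 \<noteq> {}"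
    using I1 I2 by (auto simp: frac_v_ideals_def)
  have key: "a \<in> I1 \<and> b \<in> I2"
    if a: "a \<in> quot_group H1" and b: "b \<in> quot_group H2" and ab: "a * b \<in> I1 * I2" for a b
  proof -
    obtain c d where cd: "c \<in> I1" "d \<in> I2" "a * b = c * d"
      using ab by (auto elim!: set_times_elim)
    have q: "c \<in> quot_group H1" "d \<in> quot_group H2"
      using cd sub by auto
    have nz: "a \<noteq> 0" "b \<noteq> 0" "c \<noteq> 0" "d \<noteq> 0"
      using a b q H1.quot_nonzero H2.quot_nonzero by blast+
    \<comment> \<open>The product \<open>1\<close> lies in \<open>H1 * H2\<close>, so
      \<open>split\<close> puts both quotients into the monoids, and stability carries
      \<open>c\<close> to \<open>a\<close> and \<open>d\<close> to \<open>b\<close>.\<close>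
    have "(a / c) * (b / d) = 1"
      using nz cd(3) by (simp add: field_simps)
    then have "a / c \<in> H1" "b / d \<in> H2"
      using split[of "a / c" "b / d"] H.one_in a b q by (auto simp: H1.quot_divide H2.quot_divide)
    then have "(a / c) * c \<in> I1" "(b / d) * d \<in> I2"
      using cd I1 I2 H1.v_ideal_stable H2.v_ideal_stable by blast+
    then show ?thesis
      using nz by simp
  qed
  show "pr1 (I1 * I2) = I1"
    using key sub ne by (auto simp: component_def intro: set_times_intro)
  have "pr2 (I1 * I2) = {b \<in> quot_group H2. \<exists>a\<in>quot_group H1. a * b \<in> I1 * I2}"
    by (simp add: component_def mult.commute)
  then show "pr2 (I1 * I2) = I2"
    using key sub ne by (auto intro: set_times_intro)
qed

lemma principal_image:
  "(\<lambda>I. (pr1 I, pr2 I)) ` principal_ideals (H1 * H2) = principal_ideals H1 \<times> principal_ideals H2"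
proof -
  have times: "(*) (z1 * z2) ` (H1 * H2) = ((*) z1 ` H1) * ((*) z2 ` H2)" for z1 z2
  proof
    show "(*) (z1 * z2) ` (H1 * H2) \<subseteq> ((*) z1 ` H1) * ((*) z2 ` H2)"
    proof
      fix w assume "w \<in> (*) (z1 * z2) ` (H1 * H2)"
      then obtain a b where "a \<in> H1" "b \<in> H2" "w = (z1 * a) * (z2 * b)"
        by (auto elim!: set_times_elim simp: ac_simps)
      then show "w \<in> ((*) z1 ` H1) * ((*) z2 ` H2)"
        by (auto intro!: set_times_intro)
    qed
    show "((*) z1 ` H1) * ((*) z2 ` H2) \<subseteq> (*) (z1 * z2) ` (H1 * H2)"
    proof
      fix w assume "w \<in> ((*) z1 ` H1) * ((*) z2 ` H2)"
      then obtain a b where "a \<in> H1" "b \<in> H2" "w = (z1 * z2) * (a * b)"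
        by (auto elim!: set_times_elim simp: ac_simps)
      then show "w \<in> (*) (z1 * z2) ` (H1 * H2)"
        by (auto intro!: set_times_intro)
    qed
  qed
  have pr: "pr1 ((*) (z1 * z2) ` (H1 * H2)) = (*) z1 ` H1" "pr2 ((*) (z1 * z2) ` (H1 * H2)) = (*) z2 ` H2"
    if "z1 \<in> quot_group H1" "z2 \<in> quot_group H2" for z1 z2
    using that H1.principal_subset H2.principal_subset
    by (auto simp: times principal_ideals_def subset_iff intro!: component_times)
  have "principal_ideals (H1 * H2) = (\<lambda>(z1, z2). (*) (z1 * z2) ` (H1 * H2)) ` (quot_group H1 \<times> quot_group H2)"
    unfolding principal_ideals_def quot_times by (auto elim!: set_times_elim intro: set_times_intro)
  then have "(\<lambda>I. (pr1 I, pr2 I)) ` principal_ideals (H1 * H2)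
     = (\<lambda>(z1, z2). ((*) z1 ` H1, (*) z2 ` H2)) ` (quot_group H1 \<times> quot_group H2)"
    by (auto simp: image_image pr intro!: image_cong)
  also have "\<dots> = principal_ideals H1 \<times> principal_ideals H2"
    unfolding principal_ideals_def by auto
  finally show ?thesis .
qed

text \<open>The pair of projections is inverse to \<open>I1 * I2\<close> on v-ideals, multiplicative
  by \<open>v_closure_times\<close>, and maps principal ideals onto pairs of principal ideals; the
  isomorphism then descends to quotients.\<close>

theorem class_group_times_iso: "class_group (H1 * H2) \<cong> class_group H1 \<times>\<times> class_group H2"
  unfolding class_group_def
proof (rule FactGroup_DirProd_is_iso)
  let ?k = "\<lambda>I. (pr1 I, pr2 I)"
  show "?k \<in> iso (v_ideal_group (H1 * H2)) (v_ideal_group H1 \<times>\<times> v_ideal_group H2)"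
  proof -
    have bij: "bij_betw ?k (frac_v_ideals (H1 * H2)) (frac_v_ideals H1 \<times> frac_v_ideals H2)"
    proof (rule bij_betw_byWitness[where f' = "\<lambda>(I1, I2). I1 * I2"])
      show "\<forall>I\<in>frac_v_ideals (H1 * H2). (\<lambda>(I1, I2). I1 * I2) (?k I) = I"
        using frac_v_ideal_times_ex by (fastforce simp: component_times)
      show "?k ` frac_v_ideals (H1 * H2) \<subseteq> frac_v_ideals H1 \<times> frac_v_ideals H2"
        using frac_v_ideal_times_ex by (fastforce simp: component_times)
    qed (auto simp: component_times times_frac)
    have "?k (I \<otimes>\<^bsub>v_ideal_group (H1 * H2)\<^esub> J)
        = ?k I \<otimes>\<^bsub>v_ideal_group H1 \<times>\<times> v_ideal_group H2\<^esub> ?k J"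
      if IJ: "I \<in> frac_v_ideals (H1 * H2)" "J \<in> frac_v_ideals (H1 * H2)" for I J
    proof -
      obtain I1 I2 where I: "I1 \<in> frac_v_ideals H1" "I2 \<in> frac_v_ideals H2" "I = I1 * I2"
        using frac_v_ideal_times_ex[OF IJ(1)] by auto
      obtain J1 J2 where J: "J1 \<in> frac_v_ideals H1" "J2 \<in> frac_v_ideals H2" "J = J1 * J2"
        using frac_v_ideal_times_ex[OF IJ(2)] by auto
      have "H1.fractional (I1 * J1)" "H2.fractional (I2 * J2)"
        using I J H1.fractional_times H2.fractional_times
        by (auto simp: H1.frac_v_ideals_iff H2.frac_v_ideals_iff)
      moreover have "I * J = (I1 * J1) * (I2 * J2)"
        using I J by (simp add: ac_simps)
      ultimately show ?thesis
        using I J by (simp add: H.mult_v_ideal_group H1.mult_v_ideal_group H2.mult_v_ideal_group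
            v_closure_times component_times H1.v_closure_frac H2.v_closure_frac)
    qed
    moreover have "?k \<in> frac_v_ideals (H1 * H2) \<rightarrow> frac_v_ideals H1 \<times> frac_v_ideals H2"
      using bij by (rule bij_betw_imp_funcset)
    ultimately show ?thesis
      using bij by (simp add: iso_def hom_def H1.carrier_v_ideal_group H2.carrier_v_ideal_group
          H.carrier_v_ideal_group)
  qed
  show "I \<otimes>\<^bsub>v_ideal_group (H1 * H2)\<^esub> J \<in> carrier (v_ideal_group (H1 * H2))"
    if "I \<in> carrier (v_ideal_group (H1 * H2))" "J \<in> carrier (v_ideal_group (H1 * H2))" for I J
    using that H.fractional_times H.v_closure_frac
    by (simp add: H.carrier_v_ideal_group H.mult_v_ideal_group H.frac_v_ideals_iff)
  show "principal_ideals (H1 * H2) \<subseteq> carrier (v_ideal_group (H1 * H2))"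
    by (simp add: H.carrier_v_ideal_group H.principal_subset)
  show "?k ` principal_ideals (H1 * H2) = principal_ideals H1 \<times> principal_ideals H2"
    by (rule principal_image)
  show "principal_ideals H1 \<noteq> {}" "principal_ideals H2 \<noteq> {}"
    using H1.in_quot[OF H1.one_in] H2.in_quot[OF H2.one_in] by (auto simp: principal_ideals_def)
qed

end

subsection \<open>Greatest common divisors in the quotient field\<close>

abbreviation ring_of :: "'a::idom fract set" where
  "ring_of \<equiv> range to_fract"

lemma ring_of_mult: "a \<in> ring_of \<Longrightarrow> b \<in> ring_of \<Longrightarrow> a * b \<in> ring_of"
  by (auto simp flip: to_fract_mult)

lemma fract_eq_divide:
  fixes z :: "'a::idom fract"
  obtains a b where "b \<noteq> 0" "z = to_fract a / to_fract b"
  by (metis Fract_cases Fract_conv_to_fract)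

lemma poly_fract_poly: "poly (fract_poly F) (to_fract c) = to_fract (poly F c)"
  by (induction F) (simp_all add: map_poly_pCons)

lemma to_fract_power [simp]: "to_fract (a ^ n) = to_fract a ^ n"
  by (induction n) simp_all

lemma fract_poly_power: "fract_poly (F ^ n) = fract_poly F ^ n"
  by (induction n) simp_all

lemma in_ring_of_divide_iff: "b \<noteq> 0 \<Longrightarrow> to_fract a / to_fract b \<in> ring_of \<longleftrightarrow> b dvd a"
  by (auto simp: dvd_def divide_eq_eq ac_simps simp flip: to_fract_mult)

text \<open>The gcd of the scaled set is \<open>t * w\<close>. Cancelling \<open>t\<close> makes
  \<open>w\<close> a common divisor of \<open>S\<close>, so this gcd divides \<open>t\<close> times
  the gcd of \<open>S\<close>.\<close>

lemma Gcd_factorial_scale: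
  fixes S :: "'a::{factorial_semiring,idom} set"
  assumes "\<And>s. s \<in> S \<Longrightarrow> e dvd t * s"
  shows "e dvd t * Gcd_factorial S"
proof (cases "t = 0")
  case False
  define \<gamma> where "\<gamma> = Gcd_factorial ((*) t ` S)"
  have "t dvd \<gamma>"
    unfolding \<gamma>_def by (rule Gcd_factorial_greatest) auto
  then obtain w where w: "\<gamma> = t * w" ..
  have "w dvd s" if "s \<in> S" for s
    using Gcd_factorial_dvd[of "t * s" "(*) t ` S"] that False by (simp add: w flip: \<gamma>_def)
  then have "w dvd Gcd_factorial S"
    by (rule Gcd_factorial_greatest)
  moreover have "e dvd \<gamma>"
    unfolding \<gamma>_def using assms by (auto intro: Gcd_factorial_greatest)
  ultimately show ?thesis
    using w by (metis dvd_trans mult_dvd_mono dvd_refl)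
qed simp

text \<open>A greatest common divisor \<open>\<gamma>\<close> of a fractional subset \<open>S\<close> of the quotient field is
  characterised through the elements that multiply \<open>S\<close> into the ring.\<close>

lemma fract_gcd_exists:
  fixes S :: "'a::{factorial_semiring,idom} fract set"
  assumes d: "d \<noteq> 0" "\<And>s. s \<in> S \<Longrightarrow> to_fract d * s \<in> ring_of" and ne: "\<exists>s\<in>S. s \<noteq> 0"
  obtains \<gamma> where "\<gamma> \<noteq> 0" "\<And>t. (\<forall>s\<in>S. t * s \<in> ring_of) \<longleftrightarrow> t * \<gamma> \<in> ring_of"
proof -
  define T where "T = {a. to_fract a / to_fract d \<in> S}"
  have S: "S = (\<lambda>a. to_fract a / to_fract d) ` T"
  proof -
    have "s \<in> (\<lambda>a. to_fract a / to_fract d) ` T" if "s \<in> S" for s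
    proof -
      obtain a where "to_fract d * s = to_fract a"
        using d(2)[OF \<open>s \<in> S\<close>] by auto
      then have "s = to_fract a / to_fract d"
        using d(1) by (simp add: field_simps)
      then show ?thesis
        using that by (auto simp: T_def)
    qed
    then show ?thesis
      by (auto simp: T_def)
  qed
  define g where "g = Gcd_factorial T"
  have "\<not> T \<subseteq> {0}"
    using ne by (auto simp: S)
  then have g: "g \<noteq> 0"
    by (simp add: g_def Gcd_factorial_eq_0_iff)
  have "(\<forall>s\<in>S. t * s \<in> ring_of) \<longleftrightarrow> t * (to_fract g / to_fract d) \<in> ring_of" for t
  proof -
    obtain u b where u: "b \<noteq> 0" "t = to_fract u / to_fract b"
      by (rule fract_eq_divide)
    \<comment> \<open>Over the common denominator \<open>b * d\<close> integrality becomes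
      divisibility of \<open>u * a\<close>, to which \<open>Gcd_factorial_scale\<close>
      applies.\<close>
    have *: "t * (to_fract a / to_fract d) \<in> ring_of \<longleftrightarrow> b * d dvd u * a" for a
      using in_ring_of_divide_iff[of "b * d" "u * a"] u d(1) by simp
    have "(\<forall>a\<in>T. b * d dvd u * a) \<longleftrightarrow> b * d dvd u * g"
      unfolding g_def using Gcd_factorial_scale Gcd_factorial_dvd
      by (metis dvd_refl dvd_trans mult_dvd_mono)
    then show ?thesis
      by (simp only: S ball_simps *)
  qed
  then show ?thesis
    using that[of "to_fract g / to_fract d"] g d(1) by auto
qed

text \<open>The denominator of \<open>z\<close> divides its numerator times \<open>u\<close> and
  times \<open>v\<close>, hence times their gcd, which is a unit.\<close>

lemma coprime_denominators:
  fixes u v :: "'a::{factorial_semiring,idom}"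
  assumes cop: "GCD_set u v = units"
    and "z * to_fract u \<in> ring_of" "z * to_fract v \<in> ring_of"
  shows "z \<in> ring_of"
proof -
  obtain a b where z: "b \<noteq> 0" "z = to_fract a / to_fract b"
    by (rule fract_eq_divide)
  have "b dvd a * u" "b dvd a * v"
    using assms(2,3) z in_ring_of_divide_iff[of b "a * u"] in_ring_of_divide_iff[of b "a * v"]
    by simp_all
  then have "b dvd a * Gcd_factorial {u, v}"
    by (auto intro: Gcd_factorial_scale)
  moreover have "Gcd_factorial {u, v} \<in> GCD_set u v"
    unfolding GCD_set_def by (auto intro: Gcd_factorial_dvd Gcd_factorial_greatest)
  then have "Gcd_factorial {u, v} dvd 1"
    using cop by (auto simp: units_def)
  ultimately have "b dvd a"
    using dvd_mult_unit_iff by blast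
  then show ?thesis
    using z by (simp add: in_ring_of_divide_iff)
qed

text \<open>Two inductions on \<open>coprime_denominators\<close>: \<open>step\<close> strips the
  powers of \<open>v\<close> while one factor \<open>u\<close> suffices, then the powers of
  \<open>u\<close> are removed one by one.\<close>

lemma coprime_denominators_power:
  fixes u v :: "'a::{factorial_semiring,idom}"
  assumes cop: "GCD_set u v = units"
    and u: "z * to_fract u ^ i \<in> ring_of" and v: "z * to_fract v ^ j \<in> ring_of"
  shows "z \<in> ring_of"
proof -
  have step: "w \<in> ring_of" if "w * to_fract u \<in> ring_of" "w * to_fract v ^ j \<in> ring_of" for w j
    using that(2)
  proof (induction j)
    case (Suc j)
    have "w * to_fract v ^ j * to_fract u \<in> ring_of"
      using ring_of_mult[OF that(1), of "to_fract v ^ j"] by (auto simp: ac_simps simp flip: to_fract_power)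
    moreover have "w * to_fract v ^ j * to_fract v \<in> ring_of"
      using Suc.prems by (simp add: ac_simps)
    ultimately have "w * to_fract v ^ j \<in> ring_of"
      by (rule coprime_denominators[OF cop])
    then show ?case
      by (rule Suc.IH)
  qed simp
  show ?thesis
    using u
  proof (induction i)
    case (Suc i)
    have "z * to_fract u ^ i * to_fract v ^ j \<in> ring_of"
      using ring_of_mult[OF v, of "to_fract u ^ i"] by (auto simp: ac_simps simp flip: to_fract_power)
    moreover have "z * to_fract u ^ i * to_fract u \<in> ring_of"
      using Suc.prems by (simp add: ac_simps)
    ultimately have "z * to_fract u ^ i \<in> ring_of"
      by (rule step[rotated])
    then show ?case
      by (rule Suc.IH)
  qed simp
qed

subsection \<open>Polynomials over the quotient field\<close>

text \<open>For nonzero \<open>A\<close> over a factorial domain this is primitivity. It is phrased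
  with constant primes because these stay prime in the polynomial ring, which is the form of Gauss's
  lemma used below.\<close>

definition prime_free :: "'a::idom poly \<Rightarrow> bool" where
  "prime_free A \<longleftrightarrow> (\<forall>p. prime_elem p \<longrightarrow> \<not> [:p:] dvd A)"

lemma common_denominator:
  fixes A :: "'a::idom fract poly"
  shows "\<exists>d A0. d \<noteq> 0 \<and> fract_poly A0 = smult (to_fract d) A"
proof (induction A)
  case 0
  have "fract_poly 0 = smult (to_fract (1::'a)) 0"
    by simp
  then show ?case
    by (metis one_neq_zero)
next
  case (pCons z A)
  obtain d A0 where d: "d \<noteq> 0" "fract_poly A0 = smult (to_fract d) A"
    using pCons.IH by auto
  obtain a b where ab: "b \<noteq> 0" "z = to_fract a / to_fract b"
    by (rule fract_eq_divide)
  have "fract_poly (pCons (d * a) (smult b A0)) = smult (to_fract (b * d)) (pCons z A)"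
    using d ab by (simp add: map_poly_pCons)
  then show ?case
    using d ab by (metis no_zero_divisors)
qed

lemma fract_poly_range:
  assumes "\<And>i. coeff A i \<in> ring_of"
  obtains A0 where "fract_poly A0 = A"
proof
  have inj: "inj to_fract"
    by (auto intro: injI)
  \<comment> \<open>Mapping coefficients is well behaved only for functions that fix
    \<open>0\<close>.\<close>
  have "the_inv to_fract 0 = (0::'a)"
    using the_inv_f_f[OF inj, of 0] by simp
  then show "fract_poly (map_poly (the_inv to_fract) A) = A"
    using assms by (auto intro!: poly_eqI simp: coeff_map_poly f_the_inv_into_f[OF inj])
qed

text \<open>The polynomial is divided by a gcd \<gamma> of its coefficients.\<close>

lemma prime_free_multiple:
  fixes A :: "'a::{factorial_semiring,idom} fract poly"
  assumes "A \<noteq> 0"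
  obtains \<alpha> A0 where "\<alpha> \<noteq> 0" "fract_poly A0 = smult \<alpha> A" "prime_free A0"
proof -
  obtain d A1 where d: "d \<noteq> 0" "fract_poly A1 = smult (to_fract d) A"
    using common_denominator by blast
  have "to_fract d * coeff A i \<in> ring_of" for i
    using arg_cong[OF d(2), of "\<lambda>P. coeff P i"] by (metis coeff_map_poly coeff_smult rangeI to_fract_0)
  moreover have "\<exists>s\<in>range (coeff A). s \<noteq> 0"
    using assms by (auto simp: poly_eq_iff)
  ultimately obtain \<gamma> where \<gamma>: "\<gamma> \<noteq> 0"
    "\<And>t. (\<forall>s\<in>range (coeff A). t * s \<in> ring_of) \<longleftrightarrow> t * \<gamma> \<in> ring_of"
    using fract_gcd_exists[OF d(1), of "range (coeff A)"] by blast
  have "\<forall>s\<in>range (coeff A). inverse \<gamma> * s \<in> ring_of"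
    using \<gamma>(1) range_eqI[of 1 to_fract 1] by (simp only: \<gamma>(2)) simp
  then have "coeff (smult (inverse \<gamma>) A) i \<in> ring_of" for i
    by simp
  then obtain A0 where A0: "fract_poly A0 = smult (inverse \<gamma>) A"
    using fract_poly_range by blast
  have "prime_free A0"
    unfolding prime_free_def
  proof (intro allI impI notI)
    fix p :: 'a assume p: "prime_elem p" and "[:p:] dvd A0"
    then obtain B where B: "A0 = smult p B"
      by (auto elim!: dvdE)
    then have eq: "smult (to_fract p) (fract_poly B) = smult (inverse \<gamma>) A"
      using A0 by simp
    have p0: "to_fract p \<noteq> 0"
      using p by auto
    have "inverse (\<gamma> * to_fract p) * coeff A i = to_fract (coeff B i)" for i
      using arg_cong[OF eq, of "\<lambda>P. coeff P i"] p0 \<gamma>(1) by (simp add: coeff_map_poly field_simps)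
    \<comment> \<open>If \<open>p\<close> still divided all coefficients, the characterisation of
      \<gamma> would put the inverse of \<open>p\<close> into the ring.\<close>
    then have "inverse (\<gamma> * to_fract p) * \<gamma> \<in> ring_of"
      unfolding \<gamma>(2)[symmetric] by auto
    then have "to_fract 1 / to_fract p \<in> ring_of"
      using \<gamma>(1) p0 by (simp add: field_simps)
    then have "p dvd 1"
      using p0 by (subst (asm) in_ring_of_divide_iff) auto
    then show False
      using p by (simp add: prime_elem_def)
  qed
  then show ?thesis
    using that[of "inverse \<gamma>" A0] A0 \<gamma>(1) by simp
qed

text \<open>Gauss's lemma. A denominator \<open>d\<close> of the quotient is removed prime by prime:
  each prime of \<open>d\<close> divides \<open>A0 * q1\<close> but not \<open>A0\<close>, so it can
  be cancelled from \<open>q1\<close>.\<close>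

lemma prime_free_dvd_fract_polyD:
  fixes A0 F :: "'a::{factorial_semiring,idom} poly"
  assumes pf: "prime_free A0" and dvd: "fract_poly A0 dvd fract_poly F"
  shows "A0 dvd F"
proof -
  obtain q where q: "fract_poly F = fract_poly A0 * q"
    using dvd by (elim dvdE)
  obtain d q1 where d: "d \<noteq> 0" "fract_poly q1 = smult (to_fract d) q"
    using common_denominator by blast
  have "fract_poly (smult d F) = fract_poly (A0 * q1)"
    using q d by simp
  then have "smult d F = A0 * q1"
    by (simp only: fract_poly_eq_iff)
  then show ?thesis
    using d(1)
  proof (induction d arbitrary: q1 rule: prime_divisors_induct)
    case (unit d)
    then obtain e where "e * d = 1"
      by (metis dvdE mult.commute)
    then have "F = smult e (smult d F)"
      by simp
    also have "\<dots> = A0 * smult e q1"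
      by (simp add: unit)
    finally show ?case
      by (rule dvdI)
  next
    case (factor p d)
    have p: "prime_elem p" "p \<noteq> 0"
      using factor.hyps by auto
    have "A0 * q1 = [:p:] * smult d F"
      using factor.prems(1) by (simp add: mult.commute)
    then have "[:p:] dvd A0 * q1"
      by (metis dvd_triv_left)
    then have "[:p:] dvd q1"
      using lift_prime_elem_poly[OF p(1)] pf p(1) by (auto simp: prime_elem_dvd_mult_iff prime_free_def)
    then obtain q2 where q2: "q1 = smult p q2"
      by (auto elim!: dvdE)
    have "[:p:] * smult d F = [:p:] * (A0 * q2)"
      using factor.prems(1) q2 by (simp add: mult.commute)
    then have "smult d F = A0 * q2"
      using p(2) by (metis mult_left_cancel pCons_eq_0_iff)
    then show ?case
      using factor by (intro factor.IH) auto
  qed simp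
qed

section \<open>Bezout identities and comaximal polynomials\<close>

text \<open>\<open>A\<close> is a nonzero element of least degree in the ideal generated by
  \<open>P\<close> and \<open>Q\<close>; remainders modulo \<open>A\<close> stay in that ideal and
  must vanish.\<close>

lemma poly_bezout_gcd:
  fixes P Q :: "'k::field poly"
  assumes "P \<noteq> 0"
  obtains A u v where "A = u * P + v * Q" "A \<noteq> 0" "A dvd P" "A dvd Q"
proof -
  define I where "I = {u * P + v * Q | u v. True} - {0}"
  have "P = 1 * P + 0 * Q"
    by simp
  then have "P \<in> I"
    using assms unfolding I_def by blast
  then obtain A where A: "A \<in> I" "\<And>B. B \<in> I \<Longrightarrow> degree A \<le> degree B"
    using ex_has_least_nat[of "\<lambda>B. B \<in> I" P degree] by auto
  then obtain u v where uv: "A = u * P + v * Q" and A0: "A \<noteq> 0"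
    by (auto simp: I_def)
  have dvd: "A dvd B" if "B = a * P + b * Q" for B a b
  proof (rule ccontr)
    assume not: "\<not> A dvd B"
    have "B mod A = (a - (B div A) * u) * P + (b - (B div A) * v) * Q"
      using that by (simp add: minus_div_mult_eq_mod[symmetric] uv algebra_simps)
    moreover have "B mod A \<noteq> 0"
      using not by (simp add: dvd_eq_mod_eq_0)
    ultimately have "B mod A \<in> I"
      unfolding I_def by blast
    then show False
      using A(2)[of "B mod A"] degree_mod_less_degree[OF A0 not] by simp
  qed
  have "A dvd P" "A dvd Q"
    using dvd[of P 1 0] dvd[of Q 0 1] by simp_all
  then show ?thesis
    using that uv A0 by blast
qed

text \<open>Comaximality replaces \<open>coprime\<close>, whose calculus needs a \<open>gcd\<close> operation that
  polynomials over \<open>'a fract\<close> do not carry.\<close>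

definition comaximal :: "'b::comm_ring_1 \<Rightarrow> 'b \<Rightarrow> bool" where
  "comaximal P Q \<longleftrightarrow> (\<exists>u v. u * P + v * Q = 1)"

lemma comaximal_sym: "comaximal P Q \<Longrightarrow> comaximal Q P"
  unfolding comaximal_def by (metis add.commute)

lemma comaximal_mult:
  assumes "comaximal P Q" "comaximal P Q'"
  shows "comaximal P (Q * Q')"
proof -
  obtain u v u' v' where "u * P + v * Q = 1" "u' * P + v' * Q' = 1"
    using assms by (auto simp: comaximal_def)
  then have "(u * P + v * Q) * (u' * P + v' * Q') = 1"
    by simp
  then have "(u * u' * P + u * v' * Q' + v * Q * u') * P + (v * v') * (Q * Q') = 1"
    by (simp add: algebra_simps)
  then show ?thesis
    unfolding comaximal_def by blast
qed

lemma comaximal_power: "comaximal P Q \<Longrightarrow> comaximal P (Q ^ n)"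
proof (induction n)
  case 0
  have "0 * P + 1 * 1 = (1::'a)"
    by simp
  then show ?case
    unfolding comaximal_def power_0 by blast
qed (simp add: comaximal_mult)

lemma comaximal_dvd_right: "comaximal P Q \<Longrightarrow> B dvd Q \<Longrightarrow> comaximal P B"
  unfolding comaximal_def by (metis dvdE mult.assoc mult.commute)

lemma comaximal_dvd_power:
  assumes "comaximal P Q" "A dvd P ^ i" "B dvd Q ^ j"
  shows "comaximal A B"
  using assms comaximal_power comaximal_dvd_right comaximal_sym by meson

lemma comaximal_dvd_multD:
  assumes "comaximal P Q" "P dvd Q * S"
  shows "P dvd S"
proof -
  obtain u v where "u * P + v * Q = 1"
    using assms by (auto simp: comaximal_def)
  then have "S = (u * P + v * Q) * S"
    by simp
  then have "S = P * (u * S) + (Q * S) * v"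
    by (simp add: algebra_simps)
  then show ?thesis
    using assms(2) by (metis dvd_add dvd_mult2 dvd_triv_left)
qed

text \<open>\<open>A\<close> is a gcd of \<open>P\<close> and \<open>E\<close>. The cofactors
  \<open>B\<close> of \<open>E\<close> and \<open>P'\<close> of \<open>P\<close> are comaximal and
  \<open>B\<close> divides \<open>P' * Q\<close>, so \<open>B\<close> divides
  \<open>Q\<close>.\<close>

lemma comaximal_dvd_mult_split:
  fixes P Q :: "'k::field poly"
  assumes "comaximal P Q" "P \<noteq> 0" "E dvd P * Q"
  obtains A B where "E = A * B" "A dvd P" "B dvd Q"
proof -
  obtain A u v where A: "A = u * P + v * E" "A \<noteq> 0" "A dvd P" "A dvd E"
    using poly_bezout_gcd[OF assms(2)] by blast
  obtain P' B where P': "P = A * P'" and B: "E = A * B"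
    using A(3,4) unfolding dvd_def by blast
  have "A * 1 = u * P + v * E"
    using A(1) by simp
  also have "\<dots> = A * (v * B + u * P')"
    unfolding P' B by (simp add: algebra_simps)
  finally have "A * 1 = A * (v * B + u * P')" .
  then have "comaximal B P'"
    using A(2) unfolding comaximal_def by (metis mult_left_cancel)
  moreover have "B dvd P' * Q"
    using assms(3) A(2) by (simp add: P' B mult.assoc)
  ultimately show ?thesis
    using that B A(3) comaximal_dvd_multD by blast
qed

text \<open>A gcd over the quotient field, made prime-free, divides \<open>f\<close> and
  \<open>g\<close> already over the ring, so it is a unit; its Bezout identity rescales to one for
  \<open>1\<close>.\<close>

lemma comaximal_fract_poly:
  fixes f g :: "'a::{factorial_semiring,idom} poly"
  assumes "GCD_set f g = units" "f \<noteq> 0"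
  shows "comaximal (fract_poly f) (fract_poly g)"
proof -
  obtain A u v where A: "A = u * fract_poly f + v * fract_poly g" "A \<noteq> 0"
    "A dvd fract_poly f" "A dvd fract_poly g"
    using poly_bezout_gcd[of "fract_poly f" "fract_poly g"] assms(2) by auto
  obtain \<alpha> A0 where A0: "\<alpha> \<noteq> 0" "fract_poly A0 = smult \<alpha> A" "prime_free A0"
    using prime_free_multiple[OF A(2)] by blast
  have "A0 dvd f" "A0 dvd g"
    using prime_free_dvd_fract_polyD[OF A0(3)] A(3,4) A0(1,2) by (simp_all add: smult_dvd_iff)
  moreover have "1 \<in> GCD_set f g"
    using assms(1) by (simp add: units_def)
  ultimately have "A0 dvd 1"
    by (auto simp: GCD_set_def)
  then obtain e where "e * A0 = 1"
    by (metis dvdE mult.commute)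
  then have "fract_poly e * smult \<alpha> A = 1"
    by (metis A0(2) fract_poly_mult fract_poly_1)
  then have "(smult \<alpha> (fract_poly e) * u) * fract_poly f + (smult \<alpha> (fract_poly e) * v) * fract_poly g = 1"
    by (simp add: A(1) algebra_simps smult_add_right)
  then show ?thesis
    unfolding comaximal_def by blast
qed

subsection \<open>The fixed divisor\<close>

lemma prime_elem_infinite:
  fixes p :: "'a::{factorial_semiring,idom}"
  assumes "prime_elem p"
  shows "infinite (UNIV :: 'a set)"
proof -
  have "inj (\<lambda>n. p ^ n)"
    using assms by (auto intro!: injI dest!: arg_cong[of _ _ "multiplicity p"])
  then show ?thesis
    using range_inj_infinite infinite_super[OF subset_UNIV] by blast
qed

text \<open>The hypothesis says that the domain is not a field, so there is a nonzero
  nonunit.\<close>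

lemma prime_elem_exists:
  assumes "ring_of \<noteq> (UNIV :: 'a::{factorial_semiring,idom} fract set)"
  shows "\<exists>p::'a. prime_elem p"
proof -
  obtain z :: "'a fract" where z: "z \<notin> ring_of"
    using assms by auto
  obtain a b :: 'a where ab: "b \<noteq> 0" "z = to_fract a / to_fract b"
    by (rule fract_eq_divide)
  then have "\<not> b dvd a"
    using z in_ring_of_divide_iff by blast
  then have "\<not> is_unit b"
    using unit_imp_dvd by blast
  then show ?thesis
    using prime_divisor_exists[of b] ab(1) by (auto simp: prime_def)
qed

lemma poly_infinite_nonzero:
  fixes h :: "'a::idom fract poly"
  assumes "infinite (UNIV :: 'a set)" "h \<noteq> 0"
  shows "\<exists>c. poly h (to_fract c) \<noteq> 0"
proof (rule ccontr)
  assume "\<not> ?thesis"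
  then have "range (to_fract :: 'a \<Rightarrow> _) \<subseteq> {z. poly h z = 0}"
    by auto
  then have "finite (range (to_fract :: 'a \<Rightarrow> _))"
    using poly_roots_finite[OF assms(2)] finite_subset by blast
  moreover have "inj (to_fract :: 'a \<Rightarrow> _)"
    by (auto intro: injI)
  ultimately show False
    using assms(1) by (simp add: finite_image_iff)
qed

lemma to_fract_int_eval: "h \<in> int_valued \<Longrightarrow> to_fract (int_eval h c) = poly h (to_fract c)"
  by (simp add: int_eval_def int_valued_def f_the_inv_into_f inj_def)

section \<open>Divisibility and fixed divisors through the primes in \<open>Q\<close>\<close>

context
  fixes Q :: "'a::{factorial_semiring,idom} set"
  assumes Q: "prime_reps Q"
begin

lemma prime_reps_prime: "q \<in> Q \<Longrightarrow> prime_elem q"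
  using Q by (auto simp: prime_reps_def)

lemma prime_reps_nonzero: "0 \<notin> Q"
  using prime_reps_prime[of 0] by auto

text \<open>Identifies \<open>Q\<close> with a set of normalized primes, so that finiteness of the
  set of prime divisors transfers to \<open>Q\<close>.\<close>

lemma prime_reps_inj: "inj_on normalize Q"
proof (rule inj_onI)
  fix p q assume pq: "p \<in> Q" "q \<in> Q" "normalize p = normalize q"
  then have "p dvd q" "q dvd p"
    by (metis associatedD1 associatedD2)+
  then show "p = q"
    using pq Q prime_reps_prime[of p] unfolding prime_reps_def by (metis dvd_refl)
qed

lemma prime_reps_dvdD: "p \<in> Q \<Longrightarrow> q \<in> Q \<Longrightarrow> p dvd q \<Longrightarrow> p = q"
  using prime_elem_associated[of q p] prime_reps_prime prime_reps_inj by (auto dest: inj_onD)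

lemma finite_prime_reps_divisors:
  assumes "a \<noteq> 0"
  shows "finite {q \<in> Q. q dvd a}"
proof -
  have "normalize ` {q \<in> Q. q dvd a} \<subseteq> {p. prime p \<and> p dvd a}"
    using prime_reps_prime by auto
  then have "finite (normalize ` {q \<in> Q. q dvd a})"
    using finite_prime_divisors[OF assms] finite_subset by blast
  then show ?thesis
    using prime_reps_inj by (auto simp: finite_image_iff inj_on_def)
qed

text \<open>Every prime is associated to a member of \<open>Q\<close>, and multiplicities depend
  only on the associate class.\<close>

lemma dvd_prime_repsI:
  assumes "a \<noteq> 0" "b \<noteq> 0" "\<And>q. q \<in> Q \<Longrightarrow> multiplicity q a \<le> multiplicity q b"
  shows "a dvd b"
proof -
  have "multiplicity p a \<le> multiplicity p b" if "prime p" for p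
  proof -
    have "\<exists>!q. q \<in> Q \<and> q dvd p \<and> p dvd q"
      using Q prime_imp_prime_elem[OF that] by (simp only: prime_reps_def)
    then obtain q where q: "q \<in> Q" "q dvd p" "p dvd q"
      by (elim ex1E conjE)
    then have "normalize p = normalize q"
      by (intro associatedI)
    then have "multiplicity p c = multiplicity q c" for c
      by (metis multiplicity_normalize_left)
    then show ?thesis
      using assms(3) q(1) by simp
  qed
  then have "prime_factorization a \<subseteq># prime_factorization b"
    by (intro mset_subset_eqI) (simp add: count_prime_factorization)
  then show ?thesis
    using assms by (simp add: prime_factorization_subset_iff_dvd)
qed

lemma multiplicity_prod_prime_reps:
  assumes "finite S" "S \<subseteq> Q" "q \<in> Q"
  shows "multiplicity q (\<Prod>p\<in>S. p ^ m p) = (if q \<in> S then m q else 0)"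
proof -
  have "multiplicity q (\<Prod>p\<in>S. p ^ m p) = (\<Sum>p\<in>S. multiplicity q (p ^ m p))"
    using assms prime_reps_prime prime_reps_nonzero
    by (intro prime_elem_multiplicity_prod_distrib) auto
  also have "\<dots> = (\<Sum>p\<in>S. if p = q then m q else 0)"
  proof (rule sum.cong)
    fix p assume "p \<in> S"
    then have p: "p \<in> Q"
      using assms by auto
    show "multiplicity q (p ^ m p) = (if p = q then m q else 0)"
    proof (cases "p = q")
      case False
      then have "\<not> q dvd p ^ m p"
        using prime_reps_dvdD[OF assms(3) p] prime_elem_dvd_power prime_reps_prime[OF assms(3)] by blast
      then show ?thesis
        using False by (simp add: not_dvd_imp_multiplicity_0)
    qed (use p prime_reps_prime in auto)
  qed simp
  also have "\<dots> = (if q \<in> S then m q else 0)"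
    using assms(1) by simp
  finally show ?thesis .
qed

text \<open>One nonzero value makes the infimum finite; extended naturals being well-ordered, it is
  attained, necessarily at a nonzero value.\<close>

lemma min_val:
  assumes "q \<in> Q" "int_eval h c \<noteq> 0"
  shows min_val_le: "min_val q h \<le> multiplicity q (int_eval h c)"
    and min_val_attained: "\<exists>c'. int_eval h c' \<noteq> 0 \<and> multiplicity q (int_eval h c') = min_val q h"
proof -
  define m where "m = (INF c. val q (int_eval h c))"
  have "m \<in> range (\<lambda>c. val q (int_eval h c))"
    unfolding m_def Inf_enat_def using LeastI_ex[of "\<lambda>x. x \<in> range (\<lambda>c. val q (int_eval h c))"]
    by auto
  then obtain c' where c': "m = val q (int_eval h c')"
    by auto
  have "m \<le> val q (int_eval h c)"
    unfolding m_def by (rule INF_lower) simp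
  then have le: "m \<le> enat (multiplicity q (int_eval h c))"
    using assms(2) by (simp add: val_def)
  then have "int_eval h c' \<noteq> 0"
    using c' by (auto simp: val_def)
  moreover have "min_val q h = the_enat m"
    by (simp only: min_val_def m_def)
  ultimately have "min_val q h = multiplicity q (int_eval h c')" "m = enat (min_val q h)"
    using c' \<open>min_val q h = the_enat m\<close> by (simp_all add: val_def)
  then show "\<exists>c'. int_eval h c' \<noteq> 0 \<and> multiplicity q (int_eval h c') = min_val q h"
    and "min_val q h \<le> multiplicity q (int_eval h c)"
    using \<open>int_eval h c' \<noteq> 0\<close> le by auto
qed

lemma fixed_div_nonzero: "fixed_div Q h \<noteq> 0"
proof (cases "finite {p \<in> Q. min_val p h \<noteq> 0}")
  case True
  then show ?thesis
    using prime_reps_nonzero by (auto simp: fixed_div_def)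
\<comment> \<open>Over an infinite index set the product defaults to \<open>1\<close>.\<close>
qed (simp add: fixed_div_def)

lemma multiplicity_fixed_div:
  assumes "q \<in> Q" "int_eval h c \<noteq> 0"
  shows "multiplicity q (fixed_div Q h) = min_val q h"
proof -
  \<comment> \<open>Primes with nonzero exponent divide one fixed nonzero value, so there are only
    finitely many of them.\<close>
  have "p dvd int_eval h c" if "p \<in> Q" "min_val p h \<noteq> 0" for p
    using min_val_le[OF that(1) assms(2)] that(2) by (metis le_zero_eq not_dvd_imp_multiplicity_0)
  then have "{p \<in> Q. min_val p h \<noteq> 0} \<subseteq> {p \<in> Q. p dvd int_eval h c}"
    by blast
  then have "finite {p \<in> Q. min_val p h \<noteq> 0}"
    using finite_prime_reps_divisors[OF assms(2)] finite_subset by blast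
  then show ?thesis
    using assms(1) by (auto simp: fixed_div_def multiplicity_prod_prime_reps)
qed

lemma fixed_div_dvd: "fixed_div Q h dvd int_eval h c"
proof (cases "int_eval h c = 0")
  case False
  then show ?thesis
    using fixed_div_nonzero min_val_le multiplicity_fixed_div
    by (intro dvd_prime_repsI) auto
qed simp

text \<open>For each \<open>q\<close> the exponents are compared at an argument where the minimum is
  attained. With \<open>fixed_div_dvd\<close> this makes the fixed divisor a gcd of the
  values.\<close>

lemma dvd_fixed_div:
  assumes h: "h \<in> int_valued" "h \<noteq> 0" and e: "e \<noteq> 0" "\<And>c. e dvd int_eval h c"
  shows "e dvd fixed_div Q h"
proof (cases "\<exists>c. int_eval h c \<noteq> 0")
  case True
  then obtain c where c: "int_eval h c \<noteq> 0" ..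
  show ?thesis
  proof (rule dvd_prime_repsI)
    fix q assume q: "q \<in> Q"
    obtain c' where "int_eval h c' \<noteq> 0" "multiplicity q (int_eval h c') = min_val q h"
      using min_val_attained[OF q c] by auto
    then show "multiplicity q e \<le> multiplicity q (fixed_div Q h)"
      using dvd_imp_multiplicity_le[OF e(2)] multiplicity_fixed_div[OF q c] by metis
  qed (use e fixed_div_nonzero in auto)
next
  case False
  \<comment> \<open>A nonzero \<open>h\<close> without nonzero values forces a finite domain, which
    has no primes, so \<open>e\<close> is a unit.\<close>
  then have "poly h (to_fract c) = 0" for c
    using to_fract_int_eval[OF h(1), of c] by simp
  then have "finite (UNIV :: 'a set)"
    using poly_infinite_nonzero h(2) by blast
  then have "is_unit e"
    using prime_elem_infinite prime_divisor_exists[OF e(1)] unfolding prime_def by blast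
  then show ?thesis
    by (rule unit_imp_dvd)
qed

text \<open>Admits a factor \<open>w\<close>, later a denominator: the gcd of the values behaves
  well under scaling and divides the fixed divisor.\<close>

lemma dvd_mult_fixed_div:
  assumes h: "h \<in> int_valued" "h \<noteq> 0" and e: "e \<noteq> 0" "\<And>c. e dvd w * int_eval h c"
  shows "e dvd w * fixed_div Q h"
proof (cases "\<exists>c. int_eval h c \<noteq> 0")
  case True
  define g where "g = Gcd_factorial (range (int_eval h))"
  have "e dvd w * g"
    unfolding g_def using e(2) by (auto intro: Gcd_factorial_scale)
  moreover have "g dvd fixed_div Q h"
  proof (rule dvd_fixed_div[OF h])
    show "g \<noteq> 0"
      using True by (auto simp: g_def Gcd_factorial_eq_0_iff)
  qed (auto simp: g_def intro: Gcd_factorial_dvd)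
  ultimately show ?thesis
    by (meson dvd_trans mult_dvd_mono dvd_refl)
next
  case False
  then have "e dvd fixed_div Q h"
    by (intro dvd_fixed_div h e) auto
  then show ?thesis
    by (rule dvd_mult)
qed

end

lemma poly_diff_dvd: "x - y dvd poly F x - poly F y" for F :: "'a::comm_ring_1 poly"
proof (induction F)
  case (pCons a F)
  have "poly (pCons a F) x - poly (pCons a F) y = x * (poly F x - poly F y) + (x - y) * poly F y"
    by (simp add: algebra_simps)
  then show ?case
    using pCons.IH by simp
qed simp

text \<open>A common prime factor \<open>p\<close> of \<open>f(c)\<close> and \<open>g(c)\<close> persists along \<open>c + p j\<close> for all \<open>j\<close>, so one
  exceptional argument produces infinitely many.\<close>

lemma coprime_values:
  fixes f g :: "'a::{factorial_semiring,idom} poly"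
  assumes fin: "finite {c. GCD_set (poly f c) (poly g c) \<noteq> units}"
    and nonfield: "ring_of \<noteq> (UNIV :: 'a fract set)"
  shows "GCD_set (poly f c) (poly g c) = units"
proof (rule ccontr)
  assume exc: "GCD_set (poly f c) (poly g c) \<noteq> units"
  have "\<exists>p. prime_elem p \<and> p dvd poly f c \<and> p dvd poly g c"
  proof (rule ccontr)
    assume none: "\<not> ?thesis"
    have "e dvd 1" if "e dvd poly f c" "e dvd poly g c" for e
    proof (rule ccontr)
      assume "\<not> e dvd 1"
      \<comment> \<open>For \<open>e = 0\<close> any prime will do, and one exists because the
        domain is not a field.\<close>
      then have "\<exists>p. prime_elem p \<and> p dvd e"
        using prime_divisor_exists[of e] prime_elem_exists[OF nonfield] by (cases "e = 0") auto
      then show False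
        using none that dvd_trans by blast
    qed
    then have "GCD_set (poly f c) (poly g c) = units"
      unfolding GCD_set_def units_def using unit_imp_dvd dvd_trans by blast
    with exc show False ..
  qed
  then obtain p where p: "prime_elem p" "p dvd poly f c" "p dvd poly g c"
    by blast
  have dvd: "p dvd poly F (c + p * j)" if "p dvd poly F c" for F j
  proof -
    have "p dvd poly F (c + p * j) - poly F c"
      using poly_diff_dvd[of "c + p * j" c F] by (auto intro: dvd_trans)
    then show ?thesis
      using that by (metis dvd_diff_right_iff diff_add_cancel dvd_add)
  qed
  have "GCD_set (poly f (c + p * j)) (poly g (c + p * j)) \<noteq> units" for j
  proof
    assume "GCD_set (poly f (c + p * j)) (poly g (c + p * j)) = units"
    then have "1 \<in> GCD_set (poly f (c + p * j)) (poly g (c + p * j))"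
      by (simp add: units_def)
    then have "p dvd 1"
      using dvd[OF p(2), of j] dvd[OF p(3), of j] unfolding GCD_set_def by blast
    with p(1) show False
      by (simp add: prime_elem_def)
  qed
  then have "range (\<lambda>j. c + p * j) \<subseteq> {c. GCD_set (poly f c) (poly g c) \<noteq> units}"
    by auto
  then have "finite (range (\<lambda>j. c + p * j))"
    using fin finite_subset by blast
  moreover have "inj (\<lambda>j. c + p * j)"
    using p(1) by (auto intro: injI)
  ultimately show False
    using prime_elem_infinite[OF p(1)] by (simp add: finite_image_iff)
qed

subsection \<open>Monadic submonoids\<close>

lemma int_valued_iff: "h \<in> int_valued \<longleftrightarrow> (\<forall>c. poly h (to_fract c) \<in> ring_of)"
  by (simp add: int_valued_def)

lemma int_valued_mult: "a \<in> int_valued \<Longrightarrow> b \<in> int_valued \<Longrightarrow> a * b \<in> int_valued"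
  by (simp add: int_valued_iff ring_of_mult)

lemma int_valued_1: "1 \<in> int_valued"
  using rangeI[of to_fract 1] by (simp add: int_valued_iff)

lemma int_valued_power: "a \<in> int_valued \<Longrightarrow> a ^ n \<in> int_valued"
  by (induction n) (simp_all add: int_valued_mult int_valued_1)

lemma int_valued_fract_poly: "fract_poly F \<in> int_valued"
  by (simp add: int_valued_iff poly_fract_poly)

lemma int_valued_smult: "c \<in> ring_of \<Longrightarrow> a \<in> int_valued \<Longrightarrow> smult c a \<in> int_valued"
  by (simp add: int_valued_iff ring_of_mult)

lemma monadicI:
  assumes "h \<in> int_valued" "h \<noteq> 0" "q \<in> int_valued" "h * q = f ^ k"
  shows "h \<in> monadic f"
  using assms unfolding monadic_def by force

lemma monadicE:
  assumes "h \<in> monadic f"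
  obtains q k where "h \<in> int_valued" "h \<noteq> 0" "q \<in> int_valued" "h * q = f ^ k"
proof -
  obtain k q where "h \<in> int_valued" "h \<noteq> 0" "q \<in> int_valued" "f ^ k = h * q"
    using assms unfolding monadic_def by blast
  then show ?thesis
    using that by metis
qed

lemma one_in_monadic: "1 \<in> monadic f"
  by (rule monadicI[of 1 1 f 0]) (simp_all add: int_valued_1)

lemma monadic_mult_in:
  assumes "a \<in> monadic f" "b \<in> monadic f"
  shows "a * b \<in> monadic f"
proof -
  obtain p k where a: "a \<in> int_valued" "a \<noteq> 0" "p \<in> int_valued" "a * p = f ^ k"
    using assms(1) by (rule monadicE)
  obtain q l where b: "b \<in> int_valued" "b \<noteq> 0" "q \<in> int_valued" "b * q = f ^ l"
    using assms(2) by (rule monadicE)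
  have "(a * b) * (p * q) = f ^ (k + l)"
    unfolding power_add a(4)[symmetric] b(4)[symmetric] by (simp add: ac_simps)
  then show ?thesis
    using a b by (intro monadicI[of "a * b" "p * q"]) (simp_all add: int_valued_mult)
qed

lemma monadic_subset:
  assumes "x \<in> monadic f"
  shows "monadic x \<subseteq> monadic f"
proof
  fix h assume "h \<in> monadic x"
  then obtain q k where h: "h \<in> int_valued" "h \<noteq> 0" "q \<in> int_valued" "h * q = x ^ k"
    by (rule monadicE)
  obtain p l where x: "x \<in> int_valued" "x \<noteq> 0" "p \<in> int_valued" "x * p = f ^ l"
    using assms by (rule monadicE)
  have "h * (q * p ^ k) = f ^ (l * k)"
    unfolding power_mult x(4)[symmetric] power_mult_distrib h(4)[symmetric] by (simp add: ac_simps)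
  then show "h \<in> monadic f"
    using h x by (intro monadicI[of h "q * p ^ k"]) (simp_all add: int_valued_mult int_valued_power)
qed

lemma monadic_mult_left:
  assumes "a \<in> monadic x" "y \<in> int_valued"
  shows "a \<in> monadic (x * y)"
proof -
  obtain p k where a: "a \<in> int_valued" "a \<noteq> 0" "p \<in> int_valued" "a * p = x ^ k"
    using assms(1) by (rule monadicE)
  have "a * (p * y ^ k) = (x * y) ^ k"
    unfolding power_mult_distrib a(4)[symmetric] by (simp add: ac_simps)
  then show ?thesis
    using a assms(2)
    by (intro monadicI[of a "p * y ^ k"]) (simp_all add: int_valued_mult int_valued_power)
qed

lemma monadic_mult_subset:
  assumes "a \<in> monadic x" "b \<in> monadic y" "x \<in> int_valued" "y \<in> int_valued"
  shows "a * b \<in> monadic (x * y)"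
  using monadic_mult_in monadic_mult_left[OF assms(1,4)] monadic_mult_left[OF assms(2,3)]
  by (simp add: mult.commute)

lemma unit_smult_monadic:
  assumes "c \<noteq> 0" "c \<in> ring_of" "inverse c \<in> ring_of" "h \<in> monadic x"
  shows "smult c h \<in> monadic x"
proof -
  obtain q k where h: "h \<in> int_valued" "h \<noteq> 0" "q \<in> int_valued" "h * q = x ^ k"
    using assms(4) by (rule monadicE)
  have "smult c h * smult (inverse c) q = x ^ k"
    using h(4) assms(1) by simp
  then show ?thesis
    using h assms by (intro monadicI[of _ "smult (inverse c) q"]) (simp_all add: int_valued_smult)
qed

lemma dvd_of_monadic: "h \<in> monadic f \<Longrightarrow> \<exists>k. h dvd f ^ k"
  by (metis monadicE dvd_triv_left)

lemma dvd_power_of_monadic: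
  assumes "x \<in> monadic f" "A dvd x ^ k"
  shows "\<exists>n. A dvd f ^ n"
proof -
  obtain n where "x dvd f ^ n"
    using dvd_of_monadic[OF assms(1)] ..
  then have "x ^ k dvd f ^ (n * k)"
    unfolding power_mult by (rule dvd_power_same)
  then show ?thesis
    using assms(2) dvd_trans by blast
qed

text \<open>A prime-free multiple divides the power of \<open>f\<close> already over the ring, so
  its cofactor is integer-valued.\<close>

lemma monadic_multiple:
  fixes f :: "'a::{factorial_semiring,idom} poly"
  assumes "f \<noteq> 0" "A dvd fract_poly f ^ k"
  obtains \<alpha> where "\<alpha> \<noteq> 0" "smult \<alpha> A \<in> monadic (fract_poly f)"
proof -
  have "A \<noteq> 0"
    using assms by auto
  then obtain \<alpha> A0 where A0: "\<alpha> \<noteq> 0" "fract_poly A0 = smult \<alpha> A" "prime_free A0"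
    by (rule prime_free_multiple)
  have "A0 dvd f ^ k"
    using assms(2) A0 by (intro prime_free_dvd_fract_polyD) (simp_all add: fract_poly_power smult_dvd_iff)
  then obtain B where "f ^ k = A0 * B" ..
  then have "fract_poly A0 * fract_poly B = fract_poly f ^ k"
    by (simp flip: fract_poly_power)
  then have "fract_poly A0 \<in> monadic (fract_poly f)"
    using A0(1,2) \<open>A \<noteq> 0\<close>
    by (intro monadicI[of _ "fract_poly B"] int_valued_fract_poly) auto
  then show ?thesis
    using that A0 by simp
qed

text \<open>The values of \<open>r \<in> monadic f\<close> divide powers of the values of \<open>f\<close>, so they may be
  cleared from a denominator condition.\<close>

lemma monadic_value_clear:
  assumes "r \<in> monadic (fract_poly f)"
  obtains k where "\<And>z c. z * poly r (to_fract c) \<in> ring_of \<Longrightarrow> z * to_fract (poly f c) ^ k \<in> ring_of"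
proof -
  obtain q k where r: "q \<in> int_valued" "r * q = fract_poly f ^ k"
    using assms by (rule monadicE)
  have "z * to_fract (poly f c) ^ k \<in> ring_of" if "z * poly r (to_fract c) \<in> ring_of" for z c
  proof -
    have "to_fract (poly f c) ^ k = poly (r * q) (to_fract c)"
      by (simp add: r(2) poly_fract_poly)
    then have "z * to_fract (poly f c) ^ k = (z * poly r (to_fract c)) * poly q (to_fract c)"
      by simp
    then show ?thesis
      using ring_of_mult[OF that] r(1) by (simp only: int_valued_iff)
  qed
  then show ?thesis
    using that by blast
qed

text \<open>Scale \<open>A\<close> and \<open>B\<close> to elements \<open>r\<close> and
  \<open>s\<close> of the monadic submonoids, with scaling factor \<open>u / w\<close> on the
  product. Integrality of \<open>A * B\<close> says that \<open>u\<close> divides \<open>w\<close>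
  times all values of \<open>r * s\<close>, hence \<open>w\<close> times \<open>d(r) d(s)\<close>,
  hence \<open>w * r(a) * s(b)\<close>; scaling back gives the claim.\<close>

lemma separated_values:
  fixes f g :: "'a::{factorial_semiring,idom} poly"
  assumes Q: "prime_reps Q" and nz: "f \<noteq> 0" "g \<noteq> 0"
    and d: "\<forall>r \<in> monadic (fract_poly f). \<forall>s \<in> monadic (fract_poly g).
           fixed_div Q (r * s) = fixed_div Q r * fixed_div Q s"
    and A: "A dvd fract_poly f ^ i" and B: "B dvd fract_poly g ^ j" and AB: "A * B \<in> int_valued"
  shows "poly A (to_fract a) * poly B (to_fract b) \<in> ring_of"
proof -
  obtain \<alpha> where \<alpha>: "\<alpha> \<noteq> 0" "smult \<alpha> A \<in> monadic (fract_poly f)"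
    using monadic_multiple[OF nz(1) A] by blast
  obtain \<beta> where \<beta>: "\<beta> \<noteq> 0" "smult \<beta> B \<in> monadic (fract_poly g)"
    using monadic_multiple[OF nz(2) B] by blast
  define r s where "r = smult \<alpha> A" and "s = smult \<beta> B"
  have rs: "r \<in> int_valued" "r \<noteq> 0" "s \<in> int_valued" "s \<noteq> 0"
    using \<alpha>(2) \<beta>(2) by (auto simp: r_def s_def elim: monadicE)
  obtain u w where uw: "w \<noteq> 0" "\<alpha> * \<beta> = to_fract u / to_fract w"
    by (rule fract_eq_divide)
  then have u: "u \<noteq> 0"
    using \<alpha>(1) \<beta>(1) by auto
  have int: "r * s \<in> int_valued" "r * s \<noteq> 0"
    using rs int_valued_mult by auto
  have "u dvd w * int_eval (r * s) c" for c
  proof -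
    obtain n where n: "poly (A * B) (to_fract c) = to_fract n"
      using AB by (auto simp: int_valued_iff)
    have "to_fract (int_eval (r * s) c) = (\<alpha> * \<beta>) * poly (A * B) (to_fract c)"
      unfolding to_fract_int_eval[OF int(1)] by (simp add: r_def s_def)
    then have "to_fract (w * int_eval (r * s) c) = to_fract (u * n)"
      using uw(1) unfolding uw(2) n by simp
    then show ?thesis
      by (simp only: to_fract_eq_iff) simp
  qed
  then have "u dvd w * fixed_div Q (r * s)"
    using dvd_mult_fixed_div[OF Q int u] by blast
  also have "fixed_div Q (r * s) = fixed_div Q r * fixed_div Q s"
    unfolding r_def s_def using d \<alpha>(2) \<beta>(2) by blast
  also have "w * (fixed_div Q r * fixed_div Q s) dvd w * (int_eval r a * int_eval s b)"
    using fixed_div_dvd[OF Q] by (intro mult_dvd_mono dvd_refl)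
  finally obtain n where n: "w * (int_eval r a * int_eval s b) = u * n" ..
  have "to_fract w * (poly r (to_fract a) * poly s (to_fract b)) = to_fract u * to_fract n"
    using arg_cong[OF n, of to_fract] rs by (simp add: to_fract_int_eval)
  moreover have "poly r (to_fract a) * poly s (to_fract b)
      = (\<alpha> * \<beta>) * (poly A (to_fract a) * poly B (to_fract b))"
    by (simp add: r_def s_def)
  ultimately have "to_fract u * (poly A (to_fract a) * poly B (to_fract b)) = to_fract u * to_fract n"
    using uw(1) unfolding uw(2) by simp
  then have "poly A (to_fract a) * poly B (to_fract b) = to_fract n"
    using u by simp
  then show ?thesis
    by simp
qed

section \<open>Factorisation in the monadic submonoids of a separated pair\<close>

text \<open>Bundles the consequences of the hypotheses in a form symmetric in \<open>f\<close> and
  \<open>g\<close>. Coprime values are asked for only over a nonfield, since over a field every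
  integrality claim is trivial.\<close>

locale separated_pair =
  fixes f g :: "'a::{factorial_semiring,idom} poly"
  assumes nonzero: "f \<noteq> 0" "g \<noteq> 0"
    and comax: "comaximal (fract_poly f) (fract_poly g)"
    and coprime: "ring_of \<noteq> (UNIV :: 'a fract set) \<Longrightarrow> GCD_set (poly f c) (poly g c) = units"
    and separated: "A dvd fract_poly f ^ i \<Longrightarrow> B dvd fract_poly g ^ j \<Longrightarrow> A * B \<in> int_valued
        \<Longrightarrow> poly A (to_fract a) * poly B (to_fract b) \<in> ring_of"
begin

lemma swap: "separated_pair g f"
proof
  show "GCD_set (poly g c) (poly f c) = units" if "ring_of \<noteq> (UNIV :: 'a fract set)" for c
    using coprime[OF that, of c] by (simp add: GCD_set_def conj_commute conj_left_commute)
  show "poly A (to_fract a) * poly B (to_fract b) \<in> ring_of"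
    if "A dvd fract_poly g ^ i" "B dvd fract_poly f ^ j" "A * B \<in> int_valued" for A i B j a b
    using separated[OF that(2,1), of b a] that(3) by (simp add: mult.commute)
qed (use nonzero comax comaximal_sym in auto)

lemma clear_denominators:
  assumes "z * to_fract (poly f c) ^ i \<in> ring_of" "z * to_fract (poly g c) ^ j \<in> ring_of"
  shows "z \<in> ring_of"
proof (cases "ring_of = (UNIV :: 'a fract set)")
  case False
  then show ?thesis
    using coprime_denominators_power[OF coprime assms] by blast
qed simp

text \<open>Multiplying by a scaled \<open>A(t)\<close> turns \<open>A'(t)\<close> into a multiple
  of \<open>x(t)^k\<close>, so a power of \<open>f(t)\<close> clears the denominator. Multiplying by
  \<open>y(t)^k\<close> allows regrouping as \<open>A(s) B(t)\<close> times
  \<open>A'(t) B'(t)\<close>, so a power of \<open>g(t)\<close> clears it too.\<close>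

lemma complementary_values:
  assumes x: "x \<in> monadic (fract_poly f)" and y: "y \<in> monadic (fract_poly g)"
    and eq: "A * A' = x ^ k" "B * B' = y ^ k"
    and int: "A * B \<in> int_valued" "A' * B' \<in> int_valued"
  shows "poly A (to_fract s) * poly A' (to_fract t) \<in> ring_of"
proof -
  define z where "z = poly A (to_fract s) * poly A' (to_fract t)"
  have dvds: "A dvd x ^ k" "A' dvd x ^ k" "B dvd y ^ k" "B' dvd y ^ k"
    by (simp_all flip: eq)
  obtain i i' j j' where dvd: "A dvd fract_poly f ^ i" "A' dvd fract_poly f ^ i'"
    "B dvd fract_poly g ^ j" "B' dvd fract_poly g ^ j'"
    using dvds(1,2)[THEN dvd_power_of_monadic[OF x]] dvds(3,4)[THEN dvd_power_of_monadic[OF y]]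
    by blast
  have xint: "x \<in> int_valued" and yint: "y \<in> int_valued"
    using x y by (auto elim: monadicE)
  obtain \<alpha> where \<alpha>: "\<alpha> \<noteq> 0" "smult \<alpha> A \<in> monadic (fract_poly f)"
    using monadic_multiple[OF nonzero(1) dvd(1)] by blast
  obtain m where m: "\<And>z c. z * poly (smult \<alpha> A) (to_fract c) \<in> ring_of
      \<Longrightarrow> z * to_fract (poly f c) ^ m \<in> ring_of"
    using monadic_value_clear[OF \<alpha>(2)] by blast
  have "z * poly (smult \<alpha> A) (to_fract t) = poly (smult \<alpha> A) (to_fract s) * poly (A * A') (to_fract t)"
    by (simp add: z_def)
  also have "\<dots> \<in> ring_of"
    unfolding eq using \<alpha>(2) int_valued_power[OF xint] by (intro ring_of_mult) (auto simp: int_valued_iff elim: monadicE)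
  finally have f: "z * to_fract (poly f t) ^ m \<in> ring_of"
    by (rule m)
  have "y ^ k \<in> monadic (fract_poly g)"
    using y one_in_monadic monadic_mult_in by (induction k) auto
  then obtain n where n: "\<And>z c. z * poly (y ^ k) (to_fract c) \<in> ring_of
      \<Longrightarrow> z * to_fract (poly g c) ^ n \<in> ring_of"
    using monadic_value_clear by blast
  have "z * poly (y ^ k) (to_fract t) = (poly A (to_fract s) * poly B (to_fract t))
      * (poly A' (to_fract t) * poly B' (to_fract t))"
    unfolding eq(2)[symmetric] by (simp add: z_def)
  also have "\<dots> \<in> ring_of"
    using separated[OF dvd(1,3) int(1)] separated[OF dvd(2,4) int(2)] by (blast intro: ring_of_mult)
  finally have "z * to_fract (poly g t) ^ n \<in> ring_of"
    by (rule n)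
  with f show ?thesis
    unfolding z_def by (rule clear_denominators)
qed

text \<open>The factors \<open>A\<close> and \<open>B\<close> found over the quotient field need not
  be integer-valued; a scalar \<open>c\<close> is sought that corrects them and their cofactors
  simultaneously.\<close>

lemma monadic_decompose:
  assumes x: "x \<in> monadic (fract_poly f)" and y: "y \<in> monadic (fract_poly g)"
    and h: "h \<in> monadic (x * y)"
  shows "\<exists>a\<in>monadic x. \<exists>b\<in>monadic y. h = a * b"
proof -
  obtain q k where q: "h \<in> int_valued" "q \<in> int_valued" "h * q = (x * y) ^ k" "h \<noteq> 0"
    using h by (auto elim: monadicE)
  have nz: "x \<noteq> 0" "y \<noteq> 0"
    using x y by (auto elim: monadicE)
  obtain m n where mn: "x ^ k dvd fract_poly f ^ m" "y ^ k dvd fract_poly g ^ n"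
    using dvd_power_of_monadic[OF x dvd_refl] dvd_power_of_monadic[OF y dvd_refl] by blast
  have cm: "comaximal (x ^ k) (y ^ k)"
    by (rule comaximal_dvd_power[OF comax mn])
  have "h dvd x ^ k * y ^ k"
    unfolding power_mult_distrib[symmetric] q(3)[symmetric] by simp
  then obtain A B where AB: "h = A * B" "A dvd x ^ k" "B dvd y ^ k"
    using comaximal_dvd_mult_split[OF cm power_not_zero[OF nz(1)]] by blast
  obtain A' B' where eq: "A * A' = x ^ k" "B * B' = y ^ k"
    using dvdE[OF AB(2)] dvdE[OF AB(3)] by metis
  have "h * q = (A * A') * (B * B')"
    unfolding q(3) power_mult_distrib eq ..
  then have "h * q = h * (A' * B')"
    unfolding AB(1) by (simp only: ac_simps)
  then have A'B': "q = A' * B'"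
    using mult_left_cancel[OF q(4)] by blast
  have int: "A * B \<in> int_valued" "A' * B' \<in> int_valued"
    using q AB A'B' by auto
  have dvds: "A dvd fract_poly f ^ m" "B dvd fract_poly g ^ n"
    "A' dvd fract_poly f ^ m" "B' dvd fract_poly g ^ n"
    using mn unfolding eq[symmetric] by (blast intro: dvd_mult_left dvd_mult_right)+
  have vals:
    "poly A (to_fract s) * poly A' (to_fract t) \<in> ring_of"
    "poly A (to_fract s) * poly B (to_fract t) \<in> ring_of"
    "poly B' (to_fract s) * poly A' (to_fract t) \<in> ring_of"
    "poly B' (to_fract s) * poly B (to_fract t) \<in> ring_of" for s t
  proof -
    show "poly A (to_fract s) * poly A' (to_fract t) \<in> ring_of"
      by (rule complementary_values[OF x y eq int])
    show "poly A (to_fract s) * poly B (to_fract t) \<in> ring_of"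
      by (rule separated[OF dvds(1,2) int(1)])
    show "poly B' (to_fract s) * poly A' (to_fract t) \<in> ring_of"
      using separated[OF dvds(3,4) int(2), of t s] by (simp add: mult.commute)
    show "poly B' (to_fract s) * poly B (to_fract t) \<in> ring_of"
      using eq int
      by (intro separated_pair.complementary_values[OF swap y x, where B = A' and B' = A and k = k])
        (simp_all add: mult.commute)
  qed
  have "\<exists>c. c \<noteq> 0 \<and> smult c A \<in> int_valued \<and> smult (inverse c) A' \<in> int_valued
      \<and> smult (inverse c) B \<in> int_valued \<and> smult c B' \<in> int_valued"
  proof (cases "ring_of = (UNIV :: 'a fract set)")
    case True
    then show ?thesis
      by (intro exI[of _ 1]) (simp add: int_valued_iff)
  next
    case False
    \<comment> \<open>These are the values to be multiplied by \<open>c\<close>; the values of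
      \<open>A'\<close> and \<open>B\<close> are to be divided by it. The inverse of a gcd of
      \<open>S\<close> serves as \<open>c\<close>.\<close>
    define S where "S = range (\<lambda>c. poly A (to_fract c)) \<union> range (\<lambda>c. poly B' (to_fract c))"
    obtain d A0 where d: "d \<noteq> 0" "fract_poly A0 = smult (to_fract d) A"
      using common_denominator by blast
    obtain e B0 where e: "e \<noteq> 0" "fract_poly B0 = smult (to_fract e) B'"
      using common_denominator by blast
    have "to_fract d * poly A (to_fract c) \<in> ring_of" "to_fract e * poly B' (to_fract c) \<in> ring_of" for c
      using poly_fract_poly[of A0 c] poly_fract_poly[of B0 c] d e by (metis poly_smult rangeI)+
    then have "to_fract e * (to_fract d * poly A (to_fract c)) \<in> ring_of"
      "to_fract d * (to_fract e * poly B' (to_fract c)) \<in> ring_of" for c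
      by (blast intro: ring_of_mult)+
    then have "to_fract (d * e) * s \<in> ring_of" if "s \<in> S" for s
      using that by (auto simp: S_def ac_simps)
    moreover have "\<exists>s\<in>S. s \<noteq> 0"
    proof -
      have "A \<noteq> 0"
        using q(4) AB(1) by auto
      then show ?thesis
        using poly_infinite_nonzero prime_elem_exists[OF False] prime_elem_infinite
        unfolding S_def by blast
    qed
    ultimately obtain \<gamma> where \<gamma>: "\<gamma> \<noteq> 0" "\<And>t. (\<forall>s\<in>S. t * s \<in> ring_of) \<longleftrightarrow> t * \<gamma> \<in> ring_of"
      using fract_gcd_exists[of "d * e" S] d(1) e(1) by auto
    have "\<forall>s\<in>S. inverse \<gamma> * s \<in> ring_of"
      unfolding \<gamma>(2) using \<gamma>(1) rangeI[of to_fract 1] by simp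
    then have "smult (inverse \<gamma>) A \<in> int_valued" "smult (inverse \<gamma>) B' \<in> int_valued"
      by (auto simp: S_def int_valued_iff)
    \<comment> \<open>By \<open>vals\<close> the values of \<open>A'\<close> and \<open>B\<close>
      multiply all of \<open>S\<close> into the ring, hence also its gcd \<gamma>.\<close>
    moreover have "poly A' (to_fract t) * \<gamma> \<in> ring_of" "poly B (to_fract t) * \<gamma> \<in> ring_of" for t
      unfolding \<gamma>(2)[symmetric] using vals by (auto simp: S_def mult.commute)
    then have "smult \<gamma> A' \<in> int_valued" "smult \<gamma> B \<in> int_valued"
      by (auto simp: int_valued_iff mult.commute)
    ultimately show ?thesis
      using \<gamma>(1) by (intro exI[of _ "inverse \<gamma>"]) simp
  qed
  then obtain c where c: "c \<noteq> 0" "smult c A \<in> int_valued" "smult (inverse c) A' \<in> int_valued"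
    "smult (inverse c) B \<in> int_valued" "smult c B' \<in> int_valued"
    by blast
  have "smult c A \<in> monadic x"
    using c eq AB(1) q(4) by (intro monadicI[OF c(2) _ c(3), of _ k]) auto
  moreover have "smult (inverse c) B \<in> monadic y"
    using c eq AB(1) q(4) by (intro monadicI[OF c(4) _ c(5), of _ k]) auto
  moreover have "h = smult c A * smult (inverse c) B"
    using AB(1) c(1) by simp
  ultimately show ?thesis
    by blast
qed

text \<open>Comaximality makes \<open>a\<close> and \<open>a'\<close> divide each other over the
  quotient field, so they differ by a constant \<open>c\<close>. Integrality of \<open>c\<close> and
  of its inverse follows by clearing denominators.\<close>

lemma monadic_product_cancel:
  assumes a: "a \<in> monadic (fract_poly f)" "a' \<in> monadic (fract_poly f)"
    and b: "b \<in> monadic (fract_poly g)" "b' \<in> monadic (fract_poly g)"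
    and eq: "a * b = a' * b'"
  obtains c where "c \<noteq> 0" "c \<in> ring_of" "inverse c \<in> ring_of" "a = smult c a'" "b' = smult c b"
proof -
  have comaximal: "comaximal A B" if "A \<in> monadic (fract_poly f)" "B \<in> monadic (fract_poly g)" for A B
    using dvd_of_monadic[OF that(1)] dvd_of_monadic[OF that(2)] comaximal_dvd_power[OF comax] by blast
  have nz: "a \<noteq> 0" "a' \<noteq> 0" "b \<noteq> 0" "b' \<noteq> 0"
    using a b by (auto elim: monadicE)
  have "a dvd b' * a'" "a' dvd b * a"
    using eq by (metis dvd_triv_left mult.commute)+
  then have "a dvd a'" "a' dvd a"
    using comaximal_dvd_multD comaximal a b by blast+
  then obtain w w' where w: "a = a' * w" "a' = a * w'"
    unfolding dvd_def by blast
  then have "a * 1 = a * (w' * w)"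
    by (metis mult.assoc mult.right_neutral)
  then have "w dvd 1"
    using nz(1) by (metis dvd_triv_right mult_left_cancel)
  then obtain c where "w = [:c:]" "c dvd 1"
    by (rule is_unit_polyE)
  then have c: "c \<noteq> 0" "a = smult c a'"
    using w nz by auto
  then have "a' * smult c b = a' * b'"
    using eq by (simp add: mult.commute)
  then have c': "b' = smult c b"
    using nz by (metis mult_left_cancel)
  have ring: "e \<in> ring_of"
    if A: "A' \<in> monadic (fract_poly f)" "smult e A' \<in> monadic (fract_poly f)"
      and B: "B \<in> monadic (fract_poly g)" "smult e B \<in> monadic (fract_poly g)" for e A' B
  proof -
    obtain m n where mn: "\<And>z c. z * poly A' (to_fract c) \<in> ring_of \<Longrightarrow> z * to_fract (poly f c) ^ m \<in> ring_of"
        "\<And>z c. z * poly B (to_fract c) \<in> ring_of \<Longrightarrow> z * to_fract (poly g c) ^ n \<in> ring_of"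
      using monadic_value_clear[OF A(1)] monadic_value_clear[OF B(1)] by metis
    \<comment> \<open>Any argument would serve in place of \<open>0\<close>: powers of
      \<open>f(0)\<close> and of \<open>g(0)\<close> then both clear the constant
      \<open>e\<close>.\<close>
    have "e * poly A' (to_fract 0) \<in> ring_of" "e * poly B (to_fract 0) \<in> ring_of"
      using A(2) B(2) by (auto elim!: monadicE simp: int_valued_iff simp del: to_fract_0)
    then show ?thesis
      using mn clear_denominators by blast
  qed
  have "c \<in> ring_of"
    using ring[of a' c b] a b c c' by simp
  moreover have "smult (inverse c) a = a'" "smult (inverse c) b' = b"
    using c c' by simp_all
  then have "inverse c \<in> ring_of"
    using ring[of a "inverse c" b'] a b by simp
  ultimately show ?thesis
    using that c c' by blast
qed

lemma product_submonoids_monadic: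
  assumes x: "x \<in> monadic (fract_poly f)" and y: "y \<in> monadic (fract_poly g)"
  shows "product_submonoids (to_fract ` monadic x) (to_fract ` monadic y)"
proof -
  have sub: "field_submonoid (to_fract ` monadic x)" for x :: "'a fract poly"
  proof
    show "0 \<notin> to_fract ` monadic x"
      by (auto elim: monadicE)
    show "1 \<in> to_fract ` monadic x"
      using imageI[OF one_in_monadic, of to_fract x] by simp
    show "a * b \<in> to_fract ` monadic x" if "a \<in> to_fract ` monadic x" "b \<in> to_fract ` monadic x" for a b
      using that monadic_mult_in by (force simp flip: to_fract_mult)
  qed
  have "\<alpha> \<in> to_fract ` monadic x \<and> \<beta> \<in> to_fract ` monadic y"
    if \<alpha>: "\<alpha> \<in> quot_group (to_fract ` monadic x)" and \<beta>: "\<beta> \<in> quot_group (to_fract ` monadic y)"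
      and \<alpha>\<beta>: "\<alpha> * \<beta> \<in> to_fract ` monadic x * to_fract ` monadic y" for \<alpha> \<beta>
  proof -
    obtain a a' where a: "a \<in> monadic x" "a' \<in> monadic x" "\<alpha> = to_fract a / to_fract a'"
      using \<alpha> by (auto simp: quot_group_def)
    obtain b b' where b: "b \<in> monadic y" "b' \<in> monadic y" "\<beta> = to_fract b / to_fract b'"
      using \<beta> by (auto simp: quot_group_def)
    obtain r s where rs: "r \<in> monadic x" "s \<in> monadic y" "\<alpha> * \<beta> = to_fract r * to_fract s"
      using \<alpha>\<beta> by (auto elim!: set_times_elim)
    have nz: "a' \<noteq> 0" "b' \<noteq> 0"
      using a b by (auto elim: monadicE)
    \<comment> \<open>Cross-multiplication yields two factorisations of one polynomial, so
      \<open>monadic_product_cancel\<close> supplies a unit \<open>c\<close> that corrects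
      \<open>r\<close> and \<open>s\<close>.\<close>
    have "to_fract (a * b) = to_fract ((a' * r) * (b' * s))"
      using rs(3) nz unfolding a(3) b(3) by (simp add: field_simps)
    then have eq: "a * b = (a' * r) * (b' * s)"
      by (simp only: to_fract_eq_iff)
    have "a \<in> monadic (fract_poly f)" "a' * r \<in> monadic (fract_poly f)"
      "b \<in> monadic (fract_poly g)" "b' * s \<in> monadic (fract_poly g)"
      using a b rs monadic_mult_in monadic_subset[OF x] monadic_subset[OF y] by blast+
    then obtain c where c: "c \<noteq> 0" "c \<in> ring_of" "inverse c \<in> ring_of"
      "a = smult c (a' * r)" "b' * s = smult c b"
      using eq by (rule monadic_product_cancel)
    have "b = smult (inverse c) (b' * s)"
      using c(1,5) by simp
    then have "a = a' * smult c r" "b = b' * smult (inverse c) s"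
      using c(4) by simp_all
    then have "to_fract a = to_fract a' * to_fract (smult c r)"
      "to_fract b = to_fract b' * to_fract (smult (inverse c) s)"
      by (metis to_fract_mult)+
    then have "\<alpha> = to_fract (smult c r)" "\<beta> = to_fract (smult (inverse c) s)"
      using nz unfolding a(3) b(3) by simp_all
    then show ?thesis
      using unit_smult_monadic[OF c(1-3) rs(1)] unit_smult_monadic[of "inverse c" s y] c(1-3) rs(2) by simp
  qed
  then show ?thesis
    using sub by (intro product_submonoids.intro product_submonoids_axioms.intro)
qed

lemma monadic_times:
  assumes x: "x \<in> monadic (fract_poly f)" and y: "y \<in> monadic (fract_poly g)"
  shows "to_fract ` monadic (x * y) = to_fract ` monadic x * to_fract ` monadic y"
proof
  show "to_fract ` monadic (x * y) \<subseteq> to_fract ` monadic x * to_fract ` monadic y"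
    using monadic_decompose[OF x y] by (force intro: set_times_intro)
  have "x \<in> int_valued" "y \<in> int_valued"
    using x y by (auto elim: monadicE)
  then show "to_fract ` monadic x * to_fract ` monadic y \<subseteq> to_fract ` monadic (x * y)"
    using monadic_mult_subset by (force elim!: set_times_elim simp flip: to_fract_mult)
qed

end

theorem proposition5p4:
  fixes f g :: "'a::{factorial_semiring,idom} poly"
    and Q :: "'a set"
    and x y :: "'a fract poly"
  assumes "prime_reps Q"
    and "f \<noteq> 0" and "g \<noteq> 0"
    and "GCD_set f g = units"
    and "finite {c::'a. GCD_set (poly f c) (poly g c) \<noteq> units}"
    and "\<forall>r \<in> monadic (fract_poly f). \<forall>s \<in> monadic (fract_poly g).
           fixed_div Q (r * s) = fixed_div Q r * fixed_div Q s"
    and "x \<in> monadic (fract_poly f)"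
    and "y \<in> monadic (fract_poly g)"
  shows "monadic_class_group (x * y) \<cong> monadic_class_group x \<times>\<times> monadic_class_group y"
proof -
  interpret separated_pair f g
    using assms(2,3) comaximal_fract_poly[OF assms(4,2)] coprime_values[OF assms(5)]
      separated_values[OF assms(1-3,6)]
    by unfold_locales
  interpret product_submonoids "to_fract ` monadic x" "to_fract ` monadic y"
    by (rule product_submonoids_monadic[OF assms(7,8)])
  show ?thesis
    unfolding monadic_class_group_def monadic_times[OF assms(7,8)] by (rule class_group_times_iso)
qed

end
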